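(* Let $\ell\ge 1$ be an integer and let $0<\mu<\mu_c(\ell)$. Let $H^{\mu,\ell}=W_\ell+\mu Z_\ell$ be the spherical harmonic of degree $\ell$ on $\mathbb{S}^2$ given in spherical coordinates by $h^{\mu,\ell}(\vartheta,\varphi)=\sin^{\ell}(\vartheta)\sin(\ell\varphi)+\mu\,P_\ell(\cos\vartheta)$. Then: (i) When $\ell$ is odd, the nodal set $N(H^{\mu,\ell})$ is a unique regular simple closed curve, and hence $H^{\mu,\ell}$ has exactly two nodal domains. (ii) When $\ell$ is even, the nodal set $N(H^{\mu,\ell})$ is the union of $\ell$ regular pairwise disjoint simple closed curves, and hence $H^{\mu,\ell}$ has exactly $\ell+1$ nodal domains.
   Context: $\mathbb{S}^2\subset\mathbb{R}^3$ is the unit sphere. Spherical coordinates are $E(\vartheta,\varphi)=(\sin\vartheta\cos\varphi,\sin\vartheta\sin\varphi,\cos\vartheta)$, $\vartheta\in[0,\pi]$, $\varphi\in\mathbb{R}/2\pi\mathbb{Z}$. A spherical harmonic of degree $\ell$ is the restriction to $\mathbb{S}^2$ of a harmonic homogeneous polynomial of degree $\ell$ on $\mathbb{R}^3$. The nodal set $N(u)$ of a function $u$ on $\mathbb{S}^2$ is its zero set; the nodal domains are the connected components of $\mathbb{S}^2\setminus N(u)$. $P_\ell(t)=\frac{1}{2^\ell\ell!}\frac{d^\ell}{dt^\ell}(t^2-1)^\ell$ is the Legendre polynomial of degree $\ell$. $Z_\ell$ is the spherical harmonic given in spherical coordinates by $P_\ell(\cos\vartheta)$, and $W_\ell$ is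 the restriction to $\mathbb{S}^2$ of $\mathrm{Im}\,(x+iy)^\ell$, given in spherical coordinates by $\sin^\ell(\vartheta)\sin(\ell\varphi)$. Let $0<\vartheta_1(\ell-1)<\cdots<\vartheta_{\ell-1}(\ell-1)<\pi$ be the zeros of $\vartheta\mapsto P_{\ell-1}(\cos\vartheta)$ in $(0,\pi)$. Define $$\mu_i(\ell)=\frac{\sin^\ell(\vartheta_i(\ell-1))}{|P_\ell(\cos\vartheta_i(\ell-1))|},\quad 1\le i\le \ell-1,\qquad \mu_c(\ell)=\inf_{1\le i\le[\ell/2]}\mu_i(\ell),$$ where $[\cdot]$ is the integer part (the denominators do not vanish, since $P_\ell$ and $P_{\ell-1}$ have no common zero); for $\ell=1$ the index set is empty and $\mu_c(1)=+\infty$. *)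

theory Defs
  imports "HOL-Analysis.Analysis" "HOL-Computational_Algebra.Polynomial"
begin

definition unit_sphere :: "(real ^ 3) set" where
  "unit_sphere = sphere 0 1"

definition spherical_coords :: "real \<Rightarrow> real \<Rightarrow> real ^ 3" where
  "spherical_coords \<theta> \<phi> = vector [sin \<theta> * cos \<phi>, sin \<theta> * sin \<phi>, cos \<theta>]"

definition laplacian :: "(real ^ 3 \<Rightarrow> real) \<Rightarrow> real ^ 3 \<Rightarrow> real" where
  "laplacian p x = (\<Sum>b\<in>Basis. (deriv ^^ 2) (\<lambda>t. p (x + t *\<^sub>R b)) 0)"

definition harmonic_homogeneous_polynomial :: "nat \<Rightarrow> (real ^ 3 \<Rightarrow> real) \<Rightarrow> bool" where
  "harmonic_homogeneous_polynomial l p \<longleftrightarrow>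
     real_polynomial_function p \<and> (\<forall>c x. p (c *\<^sub>R x) = c ^ l * p x) \<and> (\<forall>x. laplacian p x = 0)"

text \<open>Functions on the sphere are represented by functions on the ambient space;
  only their values on \<^const>\<open>unit_sphere\<close> are relevant.\<close>

definition spherical_harmonic :: "nat \<Rightarrow> (real ^ 3 \<Rightarrow> real) \<Rightarrow> bool" where
  "spherical_harmonic l u \<longleftrightarrow>
     (\<exists>p. harmonic_homogeneous_polynomial l p \<and> (\<forall>x\<in>unit_sphere. u x = p x))"

definition legendre :: "nat \<Rightarrow> real poly" where
  "legendre n = smult (1 / (2 ^ n * fact n)) ((pderiv ^^ n) ([:-1, 0, 1:] ^ n))"

definition Z_harm :: "nat \<Rightarrow> real ^ 3 \<Rightarrow> real" where
  "Z_harm l x = poly (legendre l) (x $ 3)"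

definition W_harm :: "nat \<Rightarrow> real ^ 3 \<Rightarrow> real" where
  "W_harm l x = Im (Complex (x $ 1) (x $ 2) ^ l)"

definition H_harm :: "real \<Rightarrow> nat \<Rightarrow> real ^ 3 \<Rightarrow> real" where
  "H_harm \<mu> l x = W_harm l x + \<mu> * Z_harm l x"

definition nodal_set :: "(real ^ 3 \<Rightarrow> real) \<Rightarrow> (real ^ 3) set" where
  "nodal_set u = {x \<in> unit_sphere. u x = 0}"

definition nodal_domains :: "(real ^ 3 \<Rightarrow> real) \<Rightarrow> (real ^ 3) set set" where
  "nodal_domains u = components (unit_sphere - nodal_set u)"

text \<open>The sequence \<open>d\<close> lists the successive derivatives of the curve.\<close>

definition smooth_curve :: "(real \<Rightarrow> real ^ 3) \<Rightarrow> bool" where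
  "smooth_curve \<gamma> \<longleftrightarrow>
     (\<exists>d :: nat \<Rightarrow> real \<Rightarrow> real ^ 3. d 0 = \<gamma> \<and>
        (\<forall>k t. (d k has_vector_derivative d (Suc k) t) (at t)))"

text \<open>A smooth periodic parametrization with nowhere vanishing velocity which is injective
  on one period; in particular the curve closes up smoothly.\<close>

definition regular_simple_closed_curve :: "(real ^ 3) set \<Rightarrow> bool" where
  "regular_simple_closed_curve C \<longleftrightarrow>
     (\<exists>\<gamma>. smooth_curve \<gamma> \<and>
          (\<forall>t. \<gamma> (t + 2 * pi) = \<gamma> t) \<and>
          (\<forall>t. vector_derivative \<gamma> (at t) \<noteq> 0) \<and>
          inj_on \<gamma> {0..<2 * pi} \<and>
          C = range \<gamma>)"

definition legendre_angles :: "nat \<Rightarrow> real set" where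
  "legendre_angles n = {\<theta>. 0 < \<theta> \<and> \<theta> < pi \<and> poly (legendre n) (cos \<theta>) = 0}"

text \<open>The \<open>i\<close>-th zero in increasing order, counted from 1.\<close>

definition legendre_angle :: "nat \<Rightarrow> nat \<Rightarrow> real" where
  "legendre_angle n i = sorted_list_of_set (legendre_angles n) ! (i - 1)"

definition mu_val :: "nat \<Rightarrow> nat \<Rightarrow> real" where
  "mu_val l i = sin (legendre_angle (l - 1) i) ^ l
                 / \<bar>poly (legendre l) (cos (legendre_angle (l - 1) i))\<bar>"

text \<open>Valued in the extended reals, so that the infimum over the empty index set is \<open>\<infinity>\<close>.\<close>

definition mu_crit :: "nat \<Rightarrow> ereal" where
  "mu_crit l = (INF i\<in>{1..l div 2}. ereal (mu_val l i))"

lemma mu_crit_1: "mu_crit 1 = \<infinity>"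
  by (simp add: mu_crit_def top_ereal_def)

lemma legendre_nonzero: "legendre n \<noteq> 0"
proof -
  let ?q = "[:-1, 0, 1:] ^ n :: real poly"
  have d: "degree ?q = 2 * n" by (subst degree_power_eq) auto
  have "?q \<noteq> 0" by simp
  hence "coeff ?q (2 * n) \<noteq> 0" using d leading_coeff_0_iff by metis
  hence "coeff ((pderiv ^^ n) ?q) n \<noteq> 0"
    using pochhammer_pos[of "1 + real n" n] by (simp add: coeff_higher_pderiv mult_2)
  hence "(pderiv ^^ n) ?q \<noteq> 0" by auto
  thus ?thesis by (simp add: legendre_def)
qed

lemma finite_legendre_angles: "finite (legendre_angles n)"
proof (rule finite_imageD)
  have "cos ` legendre_angles n \<subseteq> {t. poly (legendre n) t = 0}"
    by (auto simp: legendre_angles_def)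
  thus "finite (cos ` legendre_angles n)"
    using poly_roots_finite[OF legendre_nonzero] finite_subset by blast
  show "inj_on cos (legendre_angles n)"
    by (rule inj_onI) (auto simp: legendre_angles_def intro: cos_inj_pi)
qed

lemma spherical_coords_in_sphere: "spherical_coords \<theta> \<phi> \<in> unit_sphere"
proof -
  have "(sin \<theta> * cos \<phi>)\<^sup>2 + (sin \<theta> * sin \<phi>)\<^sup>2 + (cos \<theta>)\<^sup>2
      = (sin \<theta>)\<^sup>2 * ((sin \<phi>)\<^sup>2 + (cos \<phi>)\<^sup>2) + (cos \<theta>)\<^sup>2"
    by (simp only: power_mult_distrib distrib_left add_ac)
  also have "\<dots> = 1" by simp
  finally have "spherical_coords \<theta> \<phi> \<bullet> spherical_coords \<theta> \<phi> = 1"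
    by (simp only: spherical_coords_def inner_vec_def sum_3 vector_3 inner_real_def power2_eq_square)
  thus ?thesis
    by (simp add: unit_sphere_def norm_eq_sqrt_inner)
qed

lemma H_harm_spherical_coords:
  "H_harm \<mu> l (spherical_coords \<theta> \<phi>)
     = sin \<theta> ^ l * sin (real l * \<phi>) + \<mu> * poly (legendre l) (cos \<theta>)"
proof -
  have "Complex (sin \<theta> * cos \<phi>) (sin \<theta> * sin \<phi>) = of_real (sin \<theta>) * cis \<phi>"
    by (simp add: complex_eq_iff)
  hence "Im (Complex (sin \<theta> * cos \<phi>) (sin \<theta> * sin \<phi>) ^ l) = sin \<theta> ^ l * sin (real l * \<phi>)"
    by (simp add: power_mult_distrib Complex.DeMoivre flip: of_real_power)
  thus ?thesis
    by (simp add: H_harm_def W_harm_def Z_harm_def spherical_coords_def)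
qed

lemma sum_Basis_3:
  fixes g :: "real ^ 3 \<Rightarrow> real"
  shows "(\<Sum>b\<in>Basis. g b) = g (axis 1 1) + g (axis 2 1) + g (axis 3 1)"
proof -
  have "(\<Sum>b\<in>Basis. g b) = (\<Sum>b\<in>range (\<lambda>i::3. axis i 1 :: real ^ 3). g b)"
    by (rule sum.cong) (auto simp: Basis_vec_def)
  also have "\<dots> = (\<Sum>i\<in>UNIV. g (axis i 1))"
    by (subst sum.reindex) (auto simp: inj_on_def axis_eq_axis)
  finally show ?thesis by (simp add: sum_3)
qed

lemma harmonic_W: "harmonic_homogeneous_polynomial l (W_harm l)"
proof -
  have lin: "bounded_linear (\<lambda>x::real^3. x $ i)" for i by (rule bounded_linear_vec_nth)
  have "real_polynomial_function (\<lambda>x::real^3. Re (Complex (x $ 1) (x $ 2) ^ l)) \<and>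
        real_polynomial_function (\<lambda>x::real^3. Im (Complex (x $ 1) (x $ 2) ^ l))"
  proof (induction l)
    case (Suc l)
    show ?case
      using Suc real_polynomial_function.intros(1)[OF lin[of 1]]
        real_polynomial_function.intros(1)[OF lin[of 2]]
      by (simp add: real_polynomial_function_diff real_polynomial_function.intros(3)
          real_polynomial_function.intros(4))
  qed (auto simp: real_polynomial_function.intros(2))
  hence 1: "real_polynomial_function (W_harm l)" by (simp add: W_harm_def[abs_def])
  have 2: "W_harm l (c *\<^sub>R x) = c ^ l * W_harm l x" for c x
  proof -
    have "Complex (c * x $ 1) (c * x $ 2) = of_real c * Complex (x $ 1) (x $ 2)"
      by (simp add: complex_eq_iff)
    thus ?thesis by (simp add: W_harm_def power_mult_distrib flip: of_real_power)
  qed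
  have D: "(deriv ^^ 2) (\<lambda>t. W_harm l (x + t *\<^sub>R b)) 0
      = Im (of_nat l * of_nat (l - 1) * Complex (x $ 1) (x $ 2) ^ (l - 1 - 1) * Complex (b $ 1) (b $ 2) ^ 2)"
    for x b :: "real^3"
  proof -
    let ?w = "Complex (b $ 1) (b $ 2)" and ?z = "Complex (x $ 1) (x $ 2)"
    have e: "W_harm l (x + t *\<^sub>R b) = Im ((?z + of_real t * ?w) ^ l)" for t
      by (simp add: W_harm_def, rule arg_cong[where f = "\<lambda>c. Im (c ^ l)"], simp add: complex_eq_iff)
    have lin': "((\<lambda>t. ?z + of_real t * ?w) has_vector_derivative ?w) (at t)" for t
      by (auto intro!: derivative_eq_intros simp: has_vector_derivative_def scaleR_conv_of_real)
    have pw: "((\<lambda>t. (?z + of_real t * ?w) ^ n) has_vector_derivative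
         ?w * (of_nat n * (?z + of_real t * ?w) ^ (n - 1))) (at t)" for t n
    proof -
      have "((\<lambda>z. z ^ n) has_field_derivative of_nat n * (?z + of_real t * ?w) ^ (n - 1))
               (at (?z + of_real t * ?w))"
        by (auto intro!: derivative_eq_intros)
      from field_vector_diff_chain_at[OF lin' this] show ?thesis by (simp add: o_def)
    qed
    have d1: "deriv (\<lambda>t. W_harm l (x + t *\<^sub>R b))
        = (\<lambda>t. Im (?w * (of_nat l * (?z + of_real t * ?w) ^ (l - 1))))"
      unfolding e
    proof (rule ext, rule DERIV_imp_deriv)
      fix t :: real
      from bounded_linear.has_vector_derivative[OF bounded_linear_Im pw[of l t]]
      show "((\<lambda>t. Im ((?z + of_real t * ?w) ^ l)) has_field_derivative
              Im (?w * (of_nat l * (?z + of_real t * ?w) ^ (l - 1)))) (at t)"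
        by (simp add: has_real_derivative_iff_has_vector_derivative)
    qed
    have "((\<lambda>t. ?w * of_nat l * (?z + of_real t * ?w) ^ (l - 1)) has_vector_derivative
        ?w * of_nat l * (?w * (of_nat (l - 1) * (?z + of_real 0 * ?w) ^ (l - 1 - 1)))) (at 0)"
      by (rule has_vector_derivative_mult_right[OF pw])
    from bounded_linear.has_vector_derivative[OF bounded_linear_Im this]
    have "((\<lambda>t. Im (?w * (of_nat l * (?z + of_real t * ?w) ^ (l - 1)))) has_field_derivative
        Im (of_nat l * of_nat (l - 1) * ?z ^ (l - 1 - 1) * ?w ^ 2)) (at 0)"
      by (simp add: has_real_derivative_iff_has_vector_derivative power2_eq_square mult_ac)
    from DERIV_imp_deriv[OF this] d1 show ?thesis
      by (simp add: numeral_2_eq_2)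
  qed
  have 3: "laplacian (W_harm l) x = 0" for x
  proof -
    have ii: "Complex 0 1 ^ 2 = - 1" "Complex 1 0 = 1" "Complex 0 0 = 0"
      by (simp_all add: complex_eq_iff power2_eq_square)
    show ?thesis
      unfolding laplacian_def D sum_Basis_3 by (simp add: axis_def ii)
  qed
  show ?thesis using 1 2 3 by (simp add: harmonic_homogeneous_polynomial_def)
qed

lemma legendre_coeff_rec:
  "real (k + 2) * real (k + 1) * coeff (legendre l) (k + 2)
     = (real k - real l) * (real k + real l + 1) * coeff (legendre l) k"
proof -
  define u :: "real poly" where "u = [:-1, 0, 1:] ^ l"
  have u': "[:-1, 0, 1:] * pderiv u = smult (2 * real l) ([:0, 1:] * u)"
  proof (cases l)
    case (Suc m)
    have q: "pderiv [:-1, 0, 1:] = smult 2 [:0, 1 :: real:]" by (simp add: pderiv_pCons)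
    have "pderiv u = smult (real l) ([:-1, 0, 1:] ^ m) * smult 2 [:0, 1:]"
      by (simp only: u_def pderiv_power q) (simp add: Suc algebra_simps)
    hence "[:-1, 0, 1:] * pderiv u
        = [:-1, 0, 1:] * (smult (real l) ([:-1, 0, 1:] ^ m) * smult 2 [:0, 1:])"
      by (rule arg_cong)
    also have "\<dots> = smult (2 * real l) ([:0, 1:] * ([:-1, 0, 1:] * [:-1, 0, 1:] ^ m))"
      by (simp only: mult_smult_left mult_smult_right smult_smult mult_ac)
    finally show ?thesis by (simp only: u_def Suc power_Suc)
  qed (simp add: u_def)
  have c: "real (n + 2) * coeff u (n + 2) = (real n - 2 * real l) * coeff u n" for n
  proof -
    have m: "[:-1, 0, 1:] * q = pCons 0 (pCons 0 q) - q" "[:0, 1:] * q = pCons 0 q" for q :: "real poly"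
      by simp_all
    have "coeff (pCons 0 (pCons 0 (pderiv u)) - pderiv u) (Suc n)
        = coeff (smult (2 * real l) (pCons 0 u)) (Suc n)"
      using u' by (simp only: m)
    hence "coeff (pCons 0 (pderiv u)) n - coeff (pderiv u) (Suc n) = 2 * real l * coeff u n"
      by (simp only: coeff_diff coeff_pCons_Suc coeff_smult)
    moreover have "coeff (pCons 0 (pderiv u)) n = real n * coeff u n"
      by (cases n) (simp_all only: coeff_pCons_0 coeff_pCons_Suc coeff_pderiv of_nat_0 mult_zero_left)
    moreover have "coeff (pderiv u) (Suc n) = real (n + 2) * coeff u (n + 2)"
      by (simp add: coeff_pderiv)
    ultimately show ?thesis by (simp only: left_diff_distrib)
  qed
  have a: "coeff (legendre l) j = fact (j + l) / fact j * coeff u (j + l) / (2 ^ l * fact l)" for j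
  proof -
    have "fact (j + l) = fact j * pochhammer (real (Suc j)) l"
      using pochhammer_product'[of "1 :: real" j l] by (simp add: pochhammer_fact)
    hence "pochhammer (real (Suc j)) l = fact (j + l) / fact j" by simp
    thus ?thesis by (simp only: legendre_def u_def[symmetric] coeff_smult coeff_higher_pderiv) simp
  qed
  have "fact (Suc (Suc m)) = (real m + 2) * (real m + 1) * (fact m :: real)" for m
    by (simp only: fact_Suc of_nat_Suc) (simp add: algebra_simps)
  from this[of "k + l"] this[of k]
  have f: "fact (k + 2 + l) = (real k + real l + 2) * (real k + real l + 1) * (fact (k + l) :: real)"
    and f2: "fact (k + 2) = (real k + 2) * (real k + 1) * (fact k :: real)"
    by simp_all
  define K :: real where "K = fact (k + l) / fact k / (2 ^ l * fact l)"
  have a0: "coeff (legendre l) k = K * coeff u (k + l)"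
    by (simp add: a K_def)
  have nz: "real k + 2 \<noteq> 0" "real k + 1 \<noteq> 0" by linarith+
  have "coeff (legendre l) (k + 2) = (real k + real l + 2) * (real k + real l + 1) * fact (k + l)
      / ((real k + 2) * (real k + 1) * fact k) * coeff u (k + 2 + l) / (2 ^ l * fact l)"
    unfolding a f f2 ..
  also have "\<dots> = K * (real k + real l + 1) * ((real k + real l + 2) * coeff u (k + 2 + l))
      / ((real k + 2) * (real k + 1))"
    by (simp only: K_def times_divide_eq_left times_divide_eq_right divide_divide_eq_left mult_ac)
  also have "(real k + real l + 2) * coeff u (k + 2 + l) = (real k - real l) * coeff u (k + l)"
    using c[of "k + l"] by (simp add: add_ac)
  finally have "(real k + 2) * (real k + 1) * coeff (legendre l) (k + 2)
      = K * (real k + real l + 1) * ((real k - real l) * coeff u (k + l))"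
    using nz by simp
  thus ?thesis unfolding a0 by (simp add: mult_ac add_ac)
qed

lemma degree_legendre_le: "degree (legendre l) \<le> l"
proof (rule degree_le, intro allI impI)
  fix i assume "l < i"
  have "degree ([:-1, 0, 1:] ^ l :: real poly) = 2 * l" by (subst degree_power_eq) auto
  hence "coeff ([:-1, 0, 1:] ^ l :: real poly) (i + l) = 0"
    using \<open>l < i\<close> by (intro coeff_eq_0) simp
  thus "coeff (legendre l) i = 0" by (simp add: legendre_def coeff_higher_pderiv)
qed

lemma coeff_legendre_parity:
  assumes "odd (l + k)"
  shows "coeff (legendre l) k = 0"
  using assms
proof (induction "l - k" arbitrary: k rule: less_induct)
  case less
  show ?case
  proof (cases "k < l")
    case False
    with less.prems have "k > l" by (cases "k = l") auto
    thus ?thesis using degree_legendre_le[of l] by (intro coeff_eq_0) simp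
  next
    case True
    have "coeff (legendre l) (k + 2) = 0" using True less.prems by (intro less.hyps) auto
    with legendre_coeff_rec[of k l]
    have "(real k - real l) * (real k + real l + 1) * coeff (legendre l) k = 0" by simp
    moreover have "real k - real l \<noteq> 0" "real k + real l + 1 \<noteq> 0" using True by auto
    ultimately show ?thesis by simp
  qed
qed

lemma laplacian_monomial:
  fixes c :: "nat \<Rightarrow> real" and e :: "nat \<Rightarrow> nat" and x :: "real ^ 3"
  assumes "finite A"
  shows "laplacian (\<lambda>x. \<Sum>m\<in>A. c m * ((x $ 3) ^ e m * (x \<bullet> x) ^ m)) x
    = (\<Sum>m\<in>A. c m * (real (e m) * real (e m - 1) * (x $ 3) ^ (e m - 2) * (x \<bullet> x) ^ m
         + 2 * real m * (2 * real (e m) + 2 * real m + 1) * (x $ 3) ^ e m * (x \<bullet> x) ^ (m - 1)))"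
proof -
  define z where "z = x $ 3"
  define R where "R = x \<bullet> x"
  define G where "G d s m t = (z + t * d) ^ e m * (R + 2 * t * s + t\<^sup>2) ^ m" for d s m and t :: real
  define G1 where "G1 d s m t = real (e m) * d * (z + t * d) ^ (e m - 1) * (R + 2 * t * s + t\<^sup>2) ^ m
      + real m * (2 * s + 2 * t) * (z + t * d) ^ e m * (R + 2 * t * s + t\<^sup>2) ^ (m - 1)"
    for d s m and t :: real
  define G2 where "G2 d s m = real (e m) * real (e m - 1) * d\<^sup>2 * z ^ (e m - 2) * R ^ m
      + 4 * real (e m) * real m * d * s * z ^ (e m - 1) * R ^ (m - 1)
      + 4 * real m * real (m - 1) * s\<^sup>2 * z ^ e m * R ^ (m - 2)
      + 2 * real m * z ^ e m * R ^ (m - 1)" for d s m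
  have D: "(deriv ^^ 2) (\<lambda>t. \<Sum>m\<in>A. c m * (((x + t *\<^sub>R b) $ 3) ^ e m
              * ((x + t *\<^sub>R b) \<bullet> (x + t *\<^sub>R b)) ^ m)) 0
       = (\<Sum>m\<in>A. c m * G2 (b $ 3) (x \<bullet> b) m)" if "b \<bullet> b = 1" for b
  proof -
    have "(x + t *\<^sub>R b) \<bullet> (x + t *\<^sub>R b) = R + 2 * t * (x \<bullet> b) + t\<^sup>2" for t
      using that by (simp add: R_def inner_add_left inner_add_right inner_commute power2_eq_square)
    hence e: "(\<lambda>t. \<Sum>m\<in>A. c m * (((x + t *\<^sub>R b) $ 3) ^ e m
              * ((x + t *\<^sub>R b) \<bullet> (x + t *\<^sub>R b)) ^ m))
        = (\<lambda>t. \<Sum>m\<in>A. c m * G (b $ 3) (x \<bullet> b) m t)"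
      by (simp add: G_def z_def)
    have g1: "(G d s m has_field_derivative G1 d s m t) (at t)" for d s m t
      unfolding G_def[abs_def] G1_def
      by (auto intro!: derivative_eq_intros simp: algebra_simps)
    have g2: "(G1 d s m has_field_derivative G2 d s m) (at 0)" for d s m
      unfolding G1_def[abs_def] G2_def
      by (auto intro!: derivative_eq_intros simp: algebra_simps power2_eq_square numeral_2_eq_2)
    have "deriv (\<lambda>t. \<Sum>m\<in>A. c m * G (b $ 3) (x \<bullet> b) m t)
        = (\<lambda>t. \<Sum>m\<in>A. c m * G1 (b $ 3) (x \<bullet> b) m t)"
      by (rule ext, rule DERIV_imp_deriv, rule DERIV_sum, rule DERIV_cmult, rule g1)
    moreover have "deriv (\<lambda>t. \<Sum>m\<in>A. c m * G1 (b $ 3) (x \<bullet> b) m t) 0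
        = (\<Sum>m\<in>A. c m * G2 (b $ 3) (x \<bullet> b) m)"
      by (rule DERIV_imp_deriv, rule DERIV_sum, rule DERIV_cmult, rule g2)
    ultimately show ?thesis unfolding e by (simp add: numeral_2_eq_2)
  qed
  have "laplacian (\<lambda>x. \<Sum>m\<in>A. c m * ((x $ 3) ^ e m * (x \<bullet> x) ^ m)) x
      = (\<Sum>b\<in>Basis. \<Sum>m\<in>A. c m * G2 (b $ 3) (x \<bullet> b) m)"
    unfolding laplacian_def by (intro sum.cong refl D) (simp add: inner_Basis)
  also have "\<dots> = (\<Sum>m\<in>A. c m * (G2 0 (x $ 1) m + G2 0 (x $ 2) m + G2 1 (x $ 3) m))"
    unfolding sum_Basis_3
    by (simp add: inner_axis distrib_left sum.distrib) (simp add: axis_def)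
  also have "\<dots> = (\<Sum>m\<in>A. c m * (real (e m) * real (e m - 1) * z ^ (e m - 2) * R ^ m
         + 2 * real m * (2 * real (e m) + 2 * real m + 1) * z ^ e m * R ^ (m - 1)))"
  proof (rule sum.cong[OF refl], rule arg_cong[where f = "(*) (c _)"])
    fix m
    have R: "R = (x $ 1)\<^sup>2 + (x $ 2)\<^sup>2 + z\<^sup>2"
      by (simp add: R_def z_def inner_vec_def sum_3 power2_eq_square)
    have 1: "real (e m) * z * z ^ (e m - 1) = real (e m) * z ^ e m"
      by (cases "e m") auto
    have 2: "real m * real (m - 1) * (R * R ^ (m - 2)) = real m * (real m - 1) * R ^ (m - 1)"
    proof (cases m)
      case (Suc k)
      thus ?thesis by (cases k) auto
    qed auto
    have "G2 0 (x $ 1) m + G2 0 (x $ 2) m + G2 1 (x $ 3) m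
        = real (e m) * real (e m - 1) * z ^ (e m - 2) * R ^ m
        + 4 * real m * R ^ (m - 1) * (real (e m) * z * z ^ (e m - 1))
        + 4 * z ^ e m * (real m * real (m - 1) * (((x $ 1)\<^sup>2 + (x $ 2)\<^sup>2 + z\<^sup>2) * R ^ (m - 2)))
        + 6 * real m * z ^ e m * R ^ (m - 1)"
      by (simp add: G2_def z_def[symmetric]) (simp add: algebra_simps)
    also have "\<dots> = real (e m) * real (e m - 1) * z ^ (e m - 2) * R ^ m
         + 2 * real m * (2 * real (e m) + 2 * real m + 1) * z ^ e m * R ^ (m - 1)"
      unfolding R[symmetric] 1 2 by (simp add: algebra_simps)
    finally show "G2 0 (x $ 1) m + G2 0 (x $ 2) m + G2 1 (x $ 3) m = \<dots>" .
  qed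
  finally show ?thesis by (simp only: z_def R_def)
qed

lemma harmonic_Z:
  obtains p where "harmonic_homogeneous_polynomial l p" "\<And>x. x \<in> unit_sphere \<Longrightarrow> Z_harm l x = p x"
proof
  define a where "a m = coeff (legendre l) (l - 2 * m)" for m
  define p where "p x = (\<Sum>m\<in>{..l div 2}. a m * ((x $ 3) ^ (l - 2 * m) * (x \<bullet> x) ^ m))"
    for x :: "real ^ 3"
  show "Z_harm l x = p x" if "x \<in> unit_sphere" for x
  proof -
    have "x \<bullet> x = 1" using that by (simp add: unit_sphere_def dot_square_norm)
    have "Z_harm l x = (\<Sum>k\<le>l. coeff (legendre l) k * (x $ 3) ^ k)"
      unfolding Z_harm_def poly_altdef
      by (rule sum.mono_neutral_left) (auto simp: coeff_eq_0 intro: order_trans[OF _ degree_legendre_le])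
    also have "\<dots> = (\<Sum>k\<in>(\<lambda>m. l - 2 * m) ` {..l div 2}. coeff (legendre l) k * (x $ 3) ^ k)"
    proof (rule sum.mono_neutral_right)
      show "\<forall>k\<in>{..l} - (\<lambda>m. l - 2 * m) ` {..l div 2}. coeff (legendre l) k * (x $ 3) ^ k = 0"
      proof
        fix k assume k: "k \<in> {..l} - (\<lambda>m. l - 2 * m) ` {..l div 2}"
        have "odd (l + k)"
        proof
          assume "even (l + k)"
          hence "k = l - 2 * ((l - k) div 2)" using k by auto
          moreover have "(l - k) div 2 \<le> l div 2" by (simp add: div_le_mono)
          ultimately show False using k by blast
        qed
        thus "coeff (legendre l) k * (x $ 3) ^ k = 0" by (simp add: coeff_legendre_parity)
      qed
    qed auto
    also have "\<dots> = p x"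
      by (subst sum.reindex) (auto simp: p_def a_def \<open>x \<bullet> x = 1\<close> inj_on_def)
    finally show ?thesis .
  qed
  have "real_polynomial_function (\<lambda>x::real^3. x $ 3)"
    by (intro real_polynomial_function.intros(1) bounded_linear_vec_nth)
  moreover have "real_polynomial_function (\<lambda>x::real^3. x \<bullet> x)"
    unfolding inner_vec_def inner_real_def
    by (intro real_polynomial_function_sum real_polynomial_function.intros(4)
        real_polynomial_function.intros(1) bounded_linear_vec_nth) auto
  ultimately have 1: "real_polynomial_function p"
    unfolding p_def[abs_def]
    by (intro real_polynomial_function_sum real_polynomial_function.intros(2,4)
        real_polynomial_function_power) auto
  have 2: "p (c *\<^sub>R x) = c ^ l * p x" for c x
  proof -
    have pw: "c ^ (l - 2 * m) * (c * c) ^ m = c ^ l" if "m \<le> l div 2" for m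
    proof -
      have "c ^ (l - 2 * m) * (c * c) ^ m = c ^ (l - 2 * m + 2 * m)"
        by (simp add: power_add power_mult power2_eq_square)
      thus ?thesis using that by simp
    qed
    have "a m * (((c *\<^sub>R x) $ 3) ^ (l - 2 * m) * ((c *\<^sub>R x) \<bullet> (c *\<^sub>R x)) ^ m)
        = c ^ l * (a m * ((x $ 3) ^ (l - 2 * m) * (x \<bullet> x) ^ m))" if "m \<le> l div 2" for m
    proof -
      have "a m * (((c *\<^sub>R x) $ 3) ^ (l - 2 * m) * ((c *\<^sub>R x) \<bullet> (c *\<^sub>R x)) ^ m)
          = a m * ((c * x $ 3) ^ (l - 2 * m) * (c * c * (x \<bullet> x)) ^ m)"
        by (simp add: mult.assoc)
      also have "\<dots> = (c ^ (l - 2 * m) * (c * c) ^ m) * (a m * ((x $ 3) ^ (l - 2 * m) * (x \<bullet> x) ^ m))"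
        by (simp only: power_mult_distrib mult_ac)
      also have "c ^ (l - 2 * m) * (c * c) ^ m = c ^ l"
        by (rule pw[OF that])
      finally show ?thesis .
    qed
    thus ?thesis unfolding p_def sum_distrib_left by (intro sum.cong) auto
  qed
  have 3: "laplacian p x = 0" for x
  proof -
    define z where "z = x $ 3"
    define R where "R = x \<bullet> x"
    define N where "N = l div 2"
    define F where "F m = a m * (real (l - 2 * m) * real (l - 2 * m - 1) * z ^ (l - 2 * m - 2) * R ^ m)" for m
    define K where "K m = a m * (2 * real m * (2 * real (l - 2 * m) + 2 * real m + 1)
        * z ^ (l - 2 * m) * R ^ (m - 1))" for m
    have "laplacian p x = (\<Sum>m\<le>N. F m + K m)"
      unfolding p_def[abs_def] F_def K_def N_def z_def R_def
      by (subst laplacian_monomial) (auto simp: distrib_left)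
    also have "\<dots> = (\<Sum>m<N. F m) + F N + (K 0 + (\<Sum>m<N. K (Suc m)))"
    proof -
      have "(\<Sum>m\<le>N. F m) = (\<Sum>m<N. F m) + F N" by (simp flip: lessThan_Suc_atMost)
      thus ?thesis by (simp only: sum.distrib sum.atMost_shift[of K])
    qed
    also have "F N = 0"
    proof -
      have "l - 2 * N = 0 \<or> l - 2 * N = 1" unfolding N_def by presburger
      thus ?thesis by (auto simp: F_def)
    qed
    also have "K 0 = 0" by (simp add: K_def)
    also have "(\<Sum>m<N. F m) + 0 + (0 + (\<Sum>m<N. K (Suc m))) = (\<Sum>m<N. F m + K (Suc m))"
      by (simp add: sum.distrib)
    also have "\<dots> = 0"
    proof (rule sum.neutral, rule ballI)
      fix m assume "m \<in> {..<N}"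
      define k where "k = l - 2 * m - 2"
      have l: "l = k + 2 * m + 2" using \<open>m \<in> {..<N}\<close> by (auto simp: k_def N_def)
      have "F m + K (Suc m) = z ^ k * R ^ m * (real (k + 2) * real (k + 1) * coeff (legendre l) (k + 2)
            - (real k - real l) * (real k + real l + 1) * coeff (legendre l) k)"
        by (simp add: F_def K_def a_def l algebra_simps)
      thus "F m + K (Suc m) = 0" by (simp only: legendre_coeff_rec) simp
    qed
    finally show ?thesis .
  qed
  show "harmonic_homogeneous_polynomial l p"
    using 1 2 3 by (simp add: harmonic_homogeneous_polynomial_def)
qed

lemma harmonic_homogeneous_polynomial_combine:
  assumes "harmonic_homogeneous_polynomial l p" "harmonic_homogeneous_polynomial l q"
  shows "harmonic_homogeneous_polynomial l (\<lambda>x. p x + c * q x)"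
proof -
  have P: "real_polynomial_function p" "real_polynomial_function q"
    using assms by (auto simp: harmonic_homogeneous_polynomial_def)
  have line: "\<exists>f. \<forall>t. h (x + t *\<^sub>R b) = poly f t"
    if "real_polynomial_function h" for h :: "real ^ 3 \<Rightarrow> real" and x b
  proof -
    have "polynomial_function (\<lambda>t. x + t *\<^sub>R b)"
      by (intro polynomial_function_add polynomial_function_const polynomial_function_bounded_linear
          bounded_linear_scaleR_left)
    from real_polynomial_function_compose[OF this that]
    obtain a n where "h \<circ> (\<lambda>t. x + t *\<^sub>R b) = (\<lambda>t. \<Sum>i\<le>n. a i * t ^ i)"
      using real_polynomial_function_imp_sum by blast
    hence "h (x + t *\<^sub>R b) = poly (\<Sum>i\<le>n. monom (a i) i) t" for t
      by (simp add: fun_eq_iff poly_sum poly_monom)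
    thus ?thesis by blast
  qed
  have dp: "(deriv ^^ 2) (poly f) = poly (pderiv (pderiv f))" for f :: "real poly"
  proof -
    have "deriv (poly g) = poly (pderiv g)" for g :: "real poly"
      by (rule ext, rule DERIV_imp_deriv, rule poly_DERIV)
    thus ?thesis by (simp add: numeral_2_eq_2)
  qed
  have "(deriv ^^ 2) (\<lambda>t. p (x + t *\<^sub>R b) + c * q (x + t *\<^sub>R b)) 0
      = (deriv ^^ 2) (\<lambda>t. p (x + t *\<^sub>R b)) 0 + c * (deriv ^^ 2) (\<lambda>t. q (x + t *\<^sub>R b)) 0" for x b
  proof -
    obtain f g where "\<forall>t. p (x + t *\<^sub>R b) = poly f t" "\<forall>t. q (x + t *\<^sub>R b) = poly g t"
      using line[OF P(1), of x b] line[OF P(2), of x b] by blast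
    hence f: "(\<lambda>t. p (x + t *\<^sub>R b)) = poly f" and g: "(\<lambda>t. q (x + t *\<^sub>R b)) = poly g"
      by (auto simp: fun_eq_iff)
    have fg: "(\<lambda>t. p (x + t *\<^sub>R b) + c * q (x + t *\<^sub>R b)) = poly (f + smult c g)"
      using f g by (simp only: fun_eq_iff poly_add poly_smult) simp
    show ?thesis unfolding f g fg dp by (simp add: pderiv_add pderiv_smult)
  qed
  hence "laplacian (\<lambda>x. p x + c * q x) x = laplacian p x + c * laplacian q x" for x
    by (simp add: laplacian_def sum.distrib sum_distrib_left)
  thus ?thesis
    using assms P by (simp add: harmonic_homogeneous_polynomial_def distrib_left
        real_polynomial_function.intros(2,3,4) mult_ac)
qed

lemma spherical_harmonic_H: "spherical_harmonic l (H_harm \<mu> l)"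
proof -
  obtain p where p: "harmonic_homogeneous_polynomial l p"
    "\<And>x. x \<in> unit_sphere \<Longrightarrow> Z_harm l x = p x"
    using harmonic_Z[of l] by blast
  show ?thesis
    unfolding spherical_harmonic_def
    using harmonic_homogeneous_polynomial_combine[OF harmonic_W p(1), of \<mu>] p(2)
    by (intro exI conjI) (auto simp: H_harm_def)
qed

end

theory Submission
  imports Defs "HOL-Complex_Analysis.Complex_Analysis"
begin

text \<open>Write \<open>z = x\<^sub>1 + i x\<^sub>2\<close> and \<open>t = x\<^sub>3\<close>, so that the nodal set is
  \<open>Im z\<^sup>l = - \<mu> P\<^sub>l(t)\<close>, \<open>|z|\<^sup>2 = 1 - t\<^sup>2\<close>. It lies over the heights where
  \<open>Q(t) = (1 - t\<^sup>2)\<^sup>l - \<mu>\<^sup>2 P\<^sub>l(t)\<^sup>2\<close> is nonnegative. The critical points of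
  \<open>Q / (1 - t\<^sup>2)\<^sup>l\<close> are zeros of \<open>P\<^sub>l\<close> or of \<open>P\<^bsub>l-1\<^esub>\<close>, and \<open>\<mu> < \<mu>\<^sub>c\<close> makes \<open>Q\<close> positive there;
  hence \<open>Q(t) = (a\<^sup>2 - t\<^sup>2) R(t)\<close> with \<open>R > 0\<close> on \<open>[-a, a]\<close> and \<open>Q < 0\<close> beyond. Putting
  \<open>t = a cos s\<close>, the nodal set is \<open>z\<^sup>l = w(s)\<close> for the closed curve
  \<open>w(s) = a sin s (R(a cos s))\<^bsup>1/2\<^esup> - i \<mu> P\<^sub>l(a cos s)\<close> in the punctured plane, whose winding number
  around \<open>0\<close> is \<open>1\<close> for odd \<open>l\<close> and \<open>0\<close> for even \<open>l\<close>. So the \<open>l\<close> branches of the \<open>l\<close>-th root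
  are joined to a single closed curve in the odd case and are \<open>l\<close> disjoint closed curves in the even
  case. These branches extend holomorphically to a neighbourhood of the real line, which gives
  smoothness.

  To count nodal domains, move each point along its parallel to the nearest meridian on which
  \<open>sin (l \<phi>) = \<plusminus>1\<close>, then along this meridian to a pole or to the equator. The set \<open>H > 0\<close> is
  connected; for odd \<open>l\<close> the set \<open>H < 0\<close> is its antipodal image, and for even \<open>l\<close> a locally constant
  function with values in the \<open>l\<close>-th roots of \<open>-i\<close> separates its \<open>l\<close> components.\<close>

section \<open>Legendre polynomials\<close>

text \<open>Leibniz rule: the second derivative of X vanishes, so two terms survive. For
  \<open>n = 0\<close> the truncated exponent \<open>n - 1\<close> is harmless, its coefficient
  being 0.\<close>

lemma funpow_pderiv_mult_X:
  fixes p :: "real poly"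
  shows "(pderiv ^^ n) ([:0, 1:] * p)
     = [:0, 1:] * (pderiv ^^ n) p + smult (real n) ((pderiv ^^ (n - 1)) p)"
proof (induction n)
  case (Suc n)
  have "(pderiv ^^ Suc n) ([:0, 1:] * p)
      = pderiv ([:0, 1:] * (pderiv ^^ n) p + smult (real n) ((pderiv ^^ (n - 1)) p))"
    by (simp add: Suc.IH del: mult_pCons_left)
  also have "\<dots> = [:0, 1:] * (pderiv ^^ Suc n) p + (pderiv ^^ n) p
      + smult (real n) (pderiv ((pderiv ^^ (n - 1)) p))"
    by (simp add: pderiv_add pderiv_mult pderiv_smult pderiv_pCons)
  also have "smult (real n) (pderiv ((pderiv ^^ (n - 1)) p)) = smult (real n) ((pderiv ^^ n) p)"
    by (cases n) auto
  finally show ?case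
    by (simp add: smult_add_left)
qed simp

lemma pderiv_X2_power:
  "pderiv ([:-1, 0, 1 :: real:] ^ Suc m) = smult (2 * real (Suc m)) ([:0, 1:] * [:-1, 0, 1:] ^ m)"
proof -
  have q: "pderiv [:-1, 0, 1:] = smult 2 [:0, 1 :: real:]" by (simp add: pderiv_pCons)
  show ?thesis
    unfolding pderiv_power_Suc q
    by (simp only: mult_smult_left mult_smult_right smult_smult mult_ac)
qed

text \<open>One derivative in the Rodrigues formula turns (X^2 - 1)^(m+1) into 2(m+1) X (X^2 - 1)^m;
  the Leibniz rule for X handles the other m.\<close>

lemma legendre_Suc:
  "legendre (Suc m) = [:0, 1:] * legendre m
     + smult (real m / (2 ^ m * fact m)) ((pderiv ^^ (m - 1)) ([:-1, 0, 1:] ^ m))"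
proof -
  have "(pderiv ^^ Suc m) ([:-1, 0, 1:] ^ Suc m)
     = (pderiv ^^ m) (smult (2 * real (Suc m)) ([:0, 1:] * [:-1, 0, 1 :: real:] ^ m))"
    by (simp only: funpow_Suc_right o_apply pderiv_X2_power)
  also have "\<dots> = smult (2 * real (Suc m)) ([:0, 1:] * (pderiv ^^ m) ([:-1, 0, 1:] ^ m)
       + smult (real m) ((pderiv ^^ (m - 1)) ([:-1, 0, 1:] ^ m)))"
    by (simp only: higher_pderiv_smult funpow_pderiv_mult_X)
  finally have "legendre (Suc m) = smult (1 / (2 ^ Suc m * fact (Suc m))) (smult (2 * real (Suc m))
       ([:0, 1:] * (pderiv ^^ m) ([:-1, 0, 1:] ^ m)
       + smult (real m) ((pderiv ^^ (m - 1)) ([:-1, 0, 1:] ^ m))))"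
    by (simp only: legendre_def)
  also have "\<dots> = smult (1 / (2 ^ m * fact m)) ([:0, 1:] * (pderiv ^^ m) ([:-1, 0, 1:] ^ m)
       + smult (real m) ((pderiv ^^ (m - 1)) ([:-1, 0, 1:] ^ m)))"
  proof -
    have "1 / (2 ^ Suc m * fact (Suc m)) * (2 * real (Suc m)) = 1 / (2 ^ m * fact m)"
      by (simp add: divide_simps add_nonneg_eq_0_iff)
    thus ?thesis by (simp only: smult_smult)
  qed
  finally show ?thesis
    by (simp only: legendre_def smult_add_right mult_smult_right smult_smult) simp
qed

text \<open>With v = (X^2 - 1)^m, differentiating (X^2 - 1) v' = 2 m X v another m times expresses
  (X^2 - 1) v^(m+1) through v^(m-1), which is the remainder term of \<open>legendre_Suc\<close>;
  here (k) in the exponent of v counts derivatives.\<close>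

lemma X2_minus_1_mult_pderiv_legendre:
  "[:-1, 0, 1:] * pderiv (legendre m)
     = smult (real (Suc m)) (legendre (Suc m) - [:0, 1:] * legendre m)"
proof -
  define v :: "real poly" where "v = [:-1, 0, 1:] ^ m"
  define D where "D k = (pderiv ^^ k) v" for k
  define X :: "real poly" where "X = [:0, 1:]"
  define K where "K = 1 / (2 ^ m * fact m :: real)"
  have XX: "[:-1, 0, 1:] * q = X * (X * q) - q" for q :: "real poly"
    by (simp add: X_def)
  have "[:-1, 0, 1:] * pderiv v = smult (2 * real m) (X * v)"
  proof (cases m)
    case (Suc k)
    have "[:-1, 0, 1:] * pderiv v
        = smult (2 * real (Suc k)) (X * ([:-1, 0, 1:] * [:-1, 0, 1:] ^ k))"
      unfolding v_def Suc pderiv_X2_power X_def by (simp only: mult_smult_right mult_ac)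
    thus ?thesis by (simp only: v_def Suc power_Suc)
  qed (simp add: v_def)
  hence "(pderiv ^^ m) (X * (X * pderiv v) - pderiv v) = (pderiv ^^ m) (smult (2 * real m) (X * v))"
    by (simp only: XX)
  moreover have "(pderiv ^^ m) (X * v) = X * D m + smult (real m) (D (m - 1))"
    unfolding X_def D_def by (rule funpow_pderiv_mult_X)
  moreover have "(pderiv ^^ m) (X * (X * pderiv v) - pderiv v)
     = X * (X * D (Suc m)) + smult (2 * real m) (X * D m)
       + smult (real m * (real m - 1)) (D (m - 1)) - D (Suc m)"
  proof -
    have diff: "(pderiv ^^ k) (p - q) = (pderiv ^^ k) p - (pderiv ^^ k) q" for k and p q :: "real poly"
      by (induction k) (simp_all add: pderiv_diff)
    have D': "(pderiv ^^ k) (pderiv v) = D (Suc k)" for k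
      by (simp add: D_def funpow_swap1)
    have "(pderiv ^^ (m - 1)) (X * pderiv v)
       = X * D (Suc (m - 1)) + smult (real (m - 1)) (D (Suc (m - 1 - 1)))"
      unfolding X_def funpow_pderiv_mult_X D' ..
    hence "smult (real m) ((pderiv ^^ (m - 1)) (X * pderiv v))
       = smult (real m) (X * D m) + smult (real m * (real m - 1)) (D (m - 1))"
      \<comment> \<open>The truncated indices are off only for \<open>m\<close> equal to 0 or 1,
        where a coefficient vanishes.\<close>
      by (cases m; cases "m - 1") (simp_all add: smult_add_right)
    moreover have "(pderiv ^^ m) (X * pderiv v) = X * D (Suc m) + smult (real m) (D m)"
    proof -
      have "(pderiv ^^ m) (X * pderiv v) = X * D (Suc m) + smult (real m) (D (Suc (m - 1)))"
        unfolding X_def funpow_pderiv_mult_X D' ..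
      thus ?thesis by (cases m) simp_all
    qed
    moreover have "(pderiv ^^ m) (X * (X * pderiv v))
       = X * (pderiv ^^ m) (X * pderiv v) + smult (real m) ((pderiv ^^ (m - 1)) (X * pderiv v))"
      unfolding X_def by (rule funpow_pderiv_mult_X)
    moreover have "smult (2 * real m) (X * D m) = smult (real m) (X * D m) + smult (real m) (X * D m)"
      by (simp flip: smult_add_left)
    ultimately show ?thesis
      by (simp add: diff D' distrib_left)
  qed
  ultimately have "X * (X * D (Suc m)) - D (Suc m) = smult (real m * (real m + 1)) (D (m - 1))"
    by (simp add: higher_pderiv_smult poly_eq_iff) (simp add: algebra_simps)
  hence *: "[:-1, 0, 1:] * D (Suc m) = smult (real (Suc m) * real m) (D (m - 1))"
    by (simp only: XX of_nat_Suc) (simp only: mult.commute add.commute)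
  have "[:-1, 0, 1:] * pderiv (legendre m) = smult K ([:-1, 0, 1:] * D (Suc m))"
    by (simp add: legendre_def D_def v_def K_def pderiv_smult)
  also have "\<dots> = smult (real (Suc m)) (smult (real m * K) (D (m - 1)))"
    by (simp only: *) (simp add: mult_ac)
  also have "smult (real m * K) (D (m - 1)) = legendre (Suc m) - X * legendre m"
    by (simp add: legendre_Suc[of m] X_def K_def D_def v_def)
  finally show ?thesis by (simp only: X_def)
qed

lemma legendre_0: "legendre 0 = 1"
  by (simp add: legendre_def)

text \<open>Eliminates P_m' between the derivative of \<open>legendre_Suc\<close> (fact
  \<open>A\<close>) and the preceding identity (fact \<open>B\<close>).\<close>

lemma poly_legendre_deriv_rec:
  "(1 - t\<^sup>2) * poly (pderiv (legendre (Suc m))) t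
     = real (Suc m) * (poly (legendre m) t - t * poly (legendre (Suc m)) t)"
proof -
  define Q where "Q = smult (real m / (2 ^ m * fact m)) ((pderiv ^^ (m - 1)) ([:-1, 0, 1:] ^ m))"
  have L: "legendre (Suc m) = [:0, 1:] * legendre m + Q"
    by (simp only: legendre_Suc[of m] Q_def)
  have "pderiv Q = smult (real m) (legendre m)"
    by (cases m) (simp_all add: Q_def legendre_def pderiv_smult)
  hence "pderiv (legendre (Suc m)) = [:0, 1:] * pderiv (legendre m) + smult (real (Suc m)) (legendre m)"
    by (simp add: L pderiv_add pderiv_mult pderiv_pCons smult_add_left add_ac)
  hence A: "poly (pderiv (legendre (Suc m))) t
     = t * poly (pderiv (legendre m)) t + real (Suc m) * poly (legendre m) t"
    by simp
  have "poly ([:-1, 0, 1:] * pderiv (legendre m)) t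
     = poly (smult (real (Suc m)) (legendre (Suc m) - [:0, 1:] * legendre m)) t"
    by (simp only: X2_minus_1_mult_pderiv_legendre)
  hence B: "(t\<^sup>2 - 1) * poly (pderiv (legendre m)) t
     = real (Suc m) * (poly (legendre (Suc m)) t - t * poly (legendre m) t)"
    by (simp add: power2_eq_square algebra_simps)
  have "(1 - t\<^sup>2) * poly (pderiv (legendre (Suc m))) t
    = - t * ((t\<^sup>2 - 1) * poly (pderiv (legendre m)) t)
      + (1 - t\<^sup>2) * (real (Suc m) * poly (legendre m) t)"
    unfolding A by (simp add: algebra_simps)
  also have "\<dots> = real (Suc m) * (poly (legendre m) t - t * poly (legendre (Suc m)) t)"
    unfolding B by (simp add: algebra_simps power2_eq_square)
  finally show ?thesis .
qed

text \<open>At 1 the factor 1 - t^2 kills the derivative, so the recurrence reads P_(m+1)(1) =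
  P_m(1).\<close>

lemma poly_legendre_1: "poly (legendre l) 1 = 1"
proof (induction l)
  case (Suc l)
  thus ?case using poly_legendre_deriv_rec[of 1 l] by simp
qed (simp add: legendre_0)

lemma poly_legendre_minus: "poly (legendre l) (- t) = (- 1) ^ l * poly (legendre l) t"
proof -
  have "coeff (legendre l) i * (- t) ^ i = (- 1) ^ l * (coeff (legendre l) i * t ^ i)" for i
    by (cases "even (l + i)"; cases "even l") (auto simp: coeff_legendre_parity)
  thus ?thesis unfolding poly_altdef sum_distrib_left by (intro sum.cong refl)
qed

lemma poly_legendre_at_0: "odd l \<Longrightarrow> poly (legendre l) 0 = 0"
  using poly_legendre_minus[of l 0] by simp

section \<open>The latitudes reached by the nodal set\<close>

text \<open>This is the Q of the overview. At a nodal point of height \<open>t\<close> its value is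
  the square of Re(z^l), since |z^l|^2 = (1 - t^2)^l.\<close>

definition profile :: "nat \<Rightarrow> real \<Rightarrow> real poly" where
  "profile l \<mu> = [:1, 0, -1:] ^ l - smult (\<mu>\<^sup>2) ((legendre l)\<^sup>2)"

lemma poly_profile: "poly (profile l \<mu>) t = (1 - t\<^sup>2) ^ l - (\<mu> * poly (legendre l) t)\<^sup>2"
  by (simp add: profile_def power_mult_distrib power2_eq_square)

lemma poly_profile_minus: "poly (profile l \<mu>) (- t) = poly (profile l \<mu>) t"
  by (simp add: poly_profile poly_legendre_minus power_mult_distrib flip: power_mult)

text \<open>For |t| < 1 the left side is (1 - t^2)^(l+1) times the derivative of Q / (1 - t^2)^l;
  the recurrence for P_l' makes everything cancel except the product P_l P_(l-1), which locates the
  critical points.\<close>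

lemma poly_profile_deriv:
  assumes "l \<ge> 1"
  shows "(1 - t\<^sup>2) * poly (pderiv (profile l \<mu>)) t + 2 * real l * t * poly (profile l \<mu>) t
    = - 2 * real l * \<mu>\<^sup>2 * poly (legendre l) t * poly (legendre (l - 1)) t"
proof -
  obtain m where l: "l = Suc m" using assms by (cases l) auto
  define P where "P = legendre l"
  have "pderiv ([:1, 0, -1 :: real:] ^ l) = smult (real l) ([:1, 0, -1:] ^ m) * [:0, -2:]"
    unfolding l by (simp only: pderiv_power_Suc) (simp add: pderiv_pCons)
  hence D: "poly (pderiv (profile l \<mu>)) t
      = real l * (1 - t\<^sup>2) ^ m * (- 2 * t) - \<mu>\<^sup>2 * (2 * poly P t * poly (pderiv P) t)"
    by (simp add: profile_def pderiv_diff pderiv_smult pderiv_power P_def[symmetric] power2_eq_square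
        pderiv_mult)
  have "(1 - t\<^sup>2) * poly (pderiv (profile l \<mu>)) t
      = - 2 * real l * t * (1 - t\<^sup>2) ^ l - 2 * \<mu>\<^sup>2 * poly P t * ((1 - t\<^sup>2) * poly (pderiv P) t)"
    unfolding D by (simp add: l algebra_simps)
  also have "(1 - t\<^sup>2) * poly (pderiv P) t = real l * (poly (legendre (l - 1)) t - t * poly P t)"
    unfolding P_def l by (simp only: poly_legendre_deriv_rec diff_Suc_1)
  finally show ?thesis
    by (simp add: poly_profile P_def[symmetric] algebra_simps power2_eq_square)
qed

section \<open>Reflection symmetry of the Legendre zeros\<close>

lemma legendre_angles_reflect: "\<theta> \<in> legendre_angles n \<Longrightarrow> pi - \<theta> \<in> legendre_angles n"
  by (auto simp: legendre_angles_def poly_legendre_minus)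

lemma card_legendre_angles: "card (legendre_angles n) \<le> n"
proof -
  have "inj_on cos (legendre_angles n)"
    by (rule inj_onI) (auto simp: legendre_angles_def intro: cos_inj_pi)
  hence "card (legendre_angles n) = card (cos ` legendre_angles n)"
    by (simp add: card_image)
  also have "\<dots> \<le> card {t. poly (legendre n) t = 0}"
    by (rule card_mono) (auto simp: legendre_angles_def poly_roots_finite legendre_nonzero)
  also have "\<dots> \<le> degree (legendre n)"
    by (rule card_poly_roots_bound) (rule legendre_nonzero)
  also have "\<dots> \<le> n" by (rule degree_legendre_le)
  finally show ?thesis .
qed

text \<open>The reflection permutes the zeros and reverses their order, and a sorted distinct list
  is determined by its set.\<close>

lemma sorted_list_legendre_angles_reflect:
  "rev (map (\<lambda>\<theta>. pi - \<theta>) (sorted_list_of_set (legendre_angles n)))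
     = sorted_list_of_set (legendre_angles n)"
proof (rule sorted_distinct_set_unique)
  show "sorted (rev (map (\<lambda>\<theta>. pi - \<theta>) (sorted_list_of_set (legendre_angles n))))"
    by (simp add: sorted_wrt_rev sorted_wrt_map)
  have "(\<lambda>\<theta>. pi - \<theta>) ` legendre_angles n = legendre_angles n"
  proof
    show "legendre_angles n \<subseteq> (\<lambda>\<theta>. pi - \<theta>) ` legendre_angles n"
    proof
      fix \<theta> assume "\<theta> \<in> legendre_angles n"
      from legendre_angles_reflect[OF this] show "\<theta> \<in> (\<lambda>\<theta>. pi - \<theta>) ` legendre_angles n"
        by (intro image_eqI[of _ _ "pi - \<theta>"]) auto
    qed
  qed (auto intro: legendre_angles_reflect)
  thus "set (rev (map (\<lambda>\<theta>. pi - \<theta>) (sorted_list_of_set (legendre_angles n))))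
      = set (sorted_list_of_set (legendre_angles n))"
    by (simp add: finite_legendre_angles)
qed (auto simp: distinct_map inj_on_def)

text \<open>The infimum defining \<^const>\<open>mu_crit\<close> only runs over the zeros in the northern hemisphere
  (and the equator); the others are reached by the reflection \<open>\<theta> \<mapsto> \<pi> - \<theta>\<close>.\<close>

lemma legendre_angles_half:
  assumes "l \<ge> 1" and "\<theta> \<in> legendre_angles (l - 1)"
  obtains i where "i \<in> {1..l div 2}"
    "legendre_angle (l - 1) i = \<theta> \<or> legendre_angle (l - 1) i = pi - \<theta>"
proof -
  define xs where "xs = sorted_list_of_set (legendre_angles (l - 1))"
  have len: "length xs \<le> l - 1"
    using card_legendre_angles[of "l - 1"] by (simp add: xs_def)
  have "\<theta> \<in> set xs" using assms finite_legendre_angles by (simp add: xs_def)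
  then obtain j where j: "j < length xs" "xs ! j = \<theta>" by (auto simp: in_set_conv_nth)
  show thesis
  proof (cases "j < l div 2")
    case True
    thus thesis using j by (intro that[of "Suc j"]) (auto simp: legendre_angle_def xs_def)
  next
    case False
    \<comment> \<open>The mirror position of \<open>j\<close>. From
      \<open>length xs \<le> l - 1\<close> and \<open>j \<ge> l div 2\<close> it lies below
      \<open>l div 2\<close>; list positions start at 0, angles at 1, hence the witness
      \<open>Suc k\<close>.\<close>
    define k where "k = length xs - Suc j"
    have k: "k < length xs" "length xs - Suc k = j" using j by (auto simp: k_def)
    have "xs ! k = rev (map (\<lambda>\<theta>. pi - \<theta>) xs) ! k"
      unfolding xs_def by (simp only: sorted_list_legendre_angles_reflect)
    also have "\<dots> = pi - \<theta>" using k j by (simp add: rev_nth)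
    finally have "xs ! k = pi - \<theta>" .
    moreover have "k < l div 2" using False len j(1) assms(1) unfolding k_def by linarith
    ultimately show thesis by (intro that[of "Suc k"]) (auto simp: legendre_angle_def xs_def)
  qed
qed

text \<open>At an angle counted by \<open>mu_crit\<close> the bound on \<open>\<mu>\<close> says
  that \<mu> |P_l| is less than sin^l, which squared is Q > 0; evenness of Q covers the reflected
  angle.\<close>

lemma profile_pos_at_critical:
  assumes "l \<ge> 1" and "0 < \<mu>" and "ereal \<mu> < mu_crit l"
    and "\<bar>t\<bar> < 1" and "poly (legendre (l - 1)) t = 0"
  shows "0 < poly (profile l \<mu>) t"
proof -
  define \<theta> where "\<theta> = arccos t"
  have t: "cos \<theta> = t" and \<theta>: "0 < \<theta>" "\<theta> < pi"
    using assms(4) arccos_lt_bounded[of t] by (auto simp: \<theta>_def)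
  have "\<theta> \<in> legendre_angles (l - 1)"
    using \<theta> assms(5) by (simp add: legendre_angles_def t)
  then obtain i where i: "i \<in> {1..l div 2}"
    "legendre_angle (l - 1) i = \<theta> \<or> legendre_angle (l - 1) i = pi - \<theta>"
    using legendre_angles_half assms(1) by blast
  define \<theta>' where "\<theta>' = legendre_angle (l - 1) i"
  have s: "0 < sin \<theta>'" using i(2) \<theta> by (auto simp: \<theta>'_def sin_gt_zero)
  have "mu_crit l \<le> ereal (mu_val l i)" unfolding mu_crit_def by (rule INF_lower) fact
  hence "\<mu> < mu_val l i" using assms(3) by (meson ereal_less_le less_ereal.simps(1) order_less_le_trans)
  hence less: "\<mu> < sin \<theta>' ^ l / \<bar>poly (legendre l) (cos \<theta>')\<bar>"
    by (simp add: mu_val_def \<theta>'_def)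
  \<comment> \<open>A zero denominator would make the quotient 0 by convention, which cannot exceed
    \<open>\<mu>\<close>.\<close>
  hence "poly (legendre l) (cos \<theta>') \<noteq> 0" using assms(2) by auto
  hence "\<bar>\<mu> * poly (legendre l) (cos \<theta>')\<bar> < sin \<theta>' ^ l"
    using less assms(2) by (simp add: field_simps abs_mult)
  hence "\<bar>\<mu> * poly (legendre l) (cos \<theta>')\<bar>\<^sup>2 < (sin \<theta>' ^ l)\<^sup>2"
    by (intro power_strict_mono) auto
  moreover have "(sin \<theta>' ^ l)\<^sup>2 = (1 - (cos \<theta>')\<^sup>2) ^ l"
    by (simp only: sin_squared_eq[symmetric] power_mult[symmetric] mult.commute)
  ultimately have "0 < poly (profile l \<mu>) (cos \<theta>')" by (simp add: poly_profile)
  moreover have "cos \<theta>' = t \<or> cos \<theta>' = - t"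
    using i(2) t unfolding \<theta>'_def[symmetric] by auto
  ultimately show ?thesis by (auto simp: poly_profile_minus)
qed

text \<open>At a double zero \<open>poly_profile_deriv\<close> would give P_l P_(l-1) = 0. But P_l =
  0 makes Q = (1 - t^2)^l > 0, and P_(l-1) = 0 makes Q > 0 by the preceding lemma.\<close>

lemma profile_deriv_nonzero_at_root:
  assumes "l \<ge> 1" and "0 < \<mu>" and "ereal \<mu> < mu_crit l"
    and "\<bar>t\<bar> < 1" and "poly (profile l \<mu>) t = 0"
  shows "poly (pderiv (profile l \<mu>)) t \<noteq> 0"
proof
  assume "poly (pderiv (profile l \<mu>)) t = 0"
  hence "poly (legendre l) t = 0 \<or> poly (legendre (l - 1)) t = 0"
    using poly_profile_deriv[OF assms(1), of t \<mu>] assms by simp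
  moreover have "0 < (1 - t\<^sup>2) ^ l" using assms(4) by (simp add: abs_square_less_1)
  hence "poly (legendre l) t \<noteq> 0" using assms(5) by (auto simp: poly_profile)
  ultimately show False using profile_pos_at_critical[OF assms(1-4)] assms(5) by auto
qed

text \<open>If Q became nonnegative again at \<open>b\<close>, the quotient Q / (1 - t^2)^l, which
  drops below 0 just after \<open>a\<close>, would have a negative minimum inside
  \<open>{a..b}\<close>. There P_l P_(l-1) = 0, which forces Q > 0.\<close>

lemma profile_sign_change:
  assumes "l \<ge> 1" and "0 < \<mu>" and "ereal \<mu> < mu_crit l"
    and "0 < a" "a < b" "b \<le> 1" and "poly (profile l \<mu>) a = 0"
    and "poly (pderiv (profile l \<mu>)) a < 0"
  shows "poly (profile l \<mu>) b < 0"
proof (rule ccontr)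
  define Q where "Q = poly (profile l \<mu>)"
  define q where "q t = Q t / (1 - t\<^sup>2) ^ l" for t
  assume "\<not> poly (profile l \<mu>) b < 0"
  hence Qb: "Q b \<ge> 0" by (simp add: Q_def)
  have "Q 1 < 0" using assms(1,2) by (simp add: Q_def poly_profile poly_legendre_1 power_0_left)
  with Qb have b: "b < 1" using assms(6) by (cases "b = 1") auto
  have pos: "0 < 1 - t\<^sup>2" if "t \<in> {a..b}" for t
    using that b assms(4) by (simp add: abs_square_less_1)
  have dQ: "(Q has_field_derivative poly (pderiv (profile l \<mu>)) t) (at t)" for t
    unfolding Q_def by (rule poly_DERIV)
  obtain d where "d > 0" and d: "\<And>h. 0 < h \<Longrightarrow> h < d \<Longrightarrow> Q (a + h) < Q a"
    using DERIV_neg_dec_right[OF dQ assms(8)] by blast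
  \<comment> \<open>A point right of \<open>a\<close>, close enough for Q to be negative there and
    still left of \<open>b\<close>.\<close>
  define e where "e = a + min (d / 2) ((b - a) / 2)"
  have e: "a < e" "e < b" "Q e < 0"
    using d[of "e - a"] \<open>d > 0\<close> assms(5,7) by (auto simp: e_def Q_def min_def field_simps)
  have "continuous_on {a..b} q"
    unfolding q_def Q_def using pos by (intro continuous_intros) force
  then obtain c where c: "c \<in> {a..b}" "\<And>t. t \<in> {a..b} \<Longrightarrow> q c \<le> q t"
    using continuous_attains_inf[of "{a..b}" q] assms(5) by auto
  have "q e < 0" using e pos[of e] by (simp add: q_def divide_less_0_iff)
  with c(2)[of e] e have qc: "q c < 0" by simp
  hence Qc: "Q c < 0" using pos[OF c(1)] by (simp add: q_def divide_less_0_iff)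
  have "c \<noteq> a" "c \<noteq> b" using Qc Qb assms(7) by (auto simp: Q_def)
  hence c': "a < c" "c < b" using c(1) by auto
  obtain m where l: "l = Suc m" using assms(1) by (cases l) auto
  let ?D = "1 - c\<^sup>2" and ?Q' = "poly (pderiv (profile l \<mu>)) c"
  have "((\<lambda>t. (1 - t\<^sup>2) ^ l) has_field_derivative - (real l * 2 * c * ?D ^ (l - 1))) (at c)"
    by (auto intro!: derivative_eq_intros)
  hence "((\<lambda>t. (1 - t\<^sup>2) ^ l) has_field_derivative - (real l * 2 * c * ?D ^ m)) (at c)"
    by (simp add: l)
  from DERIV_divide[OF dQ this]
  have "(q has_field_derivative (?Q' * ?D ^ l + Q c * (real l * 2 * c * ?D ^ m)) / (?D ^ l * ?D ^ l)) (at c)"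
    unfolding q_def using pos[OF c(1)] by simp
  hence "(?Q' * ?D ^ l + Q c * (real l * 2 * c * ?D ^ m)) / (?D ^ l * ?D ^ l) = 0"
    by (rule DERIV_local_min[where d = "min (c - a) (b - c)"]) (use c' in \<open>auto intro!: c(2)\<close>)
  hence "?Q' * ?D ^ l + Q c * (real l * 2 * c * ?D ^ m) = 0"
    using pos[OF c(1)] by (simp only: divide_eq_0_iff mult_eq_0_iff power_eq_0_iff) auto
  also have "?Q' * ?D ^ l + Q c * (real l * 2 * c * ?D ^ m)
      = ?D ^ m * (?D * ?Q' + 2 * real l * c * Q c)"
    by (simp add: l algebra_simps)
  finally have "?D ^ m * (?D * ?Q' + 2 * real l * c * Q c) = 0" .
  hence "poly (legendre l) c = 0 \<or> poly (legendre (l - 1)) c = 0"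
    using poly_profile_deriv[OF assms(1), of c \<mu>] pos[OF c(1)] assms(1,2)
    by (simp add: Q_def)
  moreover have "0 < ?D ^ l" using pos[OF c(1)] by simp  have "poly (legendre l) c \<noteq> 0"
  proof
    assume "poly (legendre l) c = 0"
    hence "Q c = ?D ^ l" by (simp add: Q_def poly_profile)
    thus False using Qc \<open>0 < ?D ^ l\<close> by linarith
  qed
  moreover have "\<bar>c\<bar> < 1" using c' assms(4) b by auto
  ultimately show False using profile_pos_at_critical[OF assms(1-3), of c] Qc by (auto simp: Q_def)
qed

text \<open>Take for \<open>a\<close> the least zero of Q in [0, 1]; evenness gives the zero -a.
  Simplicity of these zeros keeps \<open>R\<close> positive up to \<plusminus>a, so Q'(a) = -2 a
  R(a) < 0 and the sign change propagates to 1. A zero of P_l beyond \<open>a\<close> would make Q =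
  (1 - t^2)^l, against its sign.\<close>

lemma profile_factorization:
  assumes "l \<ge> 1" and "0 < \<mu>" and "ereal \<mu> < mu_crit l"
  obtains a R where "0 < a" "a < 1" "profile l \<mu> = [:a\<^sup>2, 0, -1:] * R"
    "\<And>t. \<bar>t\<bar> \<le> a \<Longrightarrow> 0 < poly R t"
    "\<And>t. a < \<bar>t\<bar> \<Longrightarrow> \<bar>t\<bar> \<le> 1 \<Longrightarrow> poly (profile l \<mu>) t < 0"
    "\<And>t. a \<le> t \<Longrightarrow> t \<le> 1 \<Longrightarrow> 0 < poly (legendre l) t"
proof -
  define Q where "Q = profile l \<mu>"
  \<comment> \<open>For odd \<open>l\<close>, P_l(0) = 0 and so Q(0) = 1; for even \<open>l\<close>,
    0 is a zero of P_(l-1), hence critical.\<close>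
  have "0 < poly Q 0"
  proof (cases "odd l")
    case True
    thus ?thesis by (simp add: Q_def poly_profile poly_legendre_at_0)
  next
    case False
    thus ?thesis unfolding Q_def using assms
      by (intro profile_pos_at_critical poly_legendre_at_0) auto
  qed
  moreover have Q1: "poly Q 1 < 0"
    using assms(1,2) by (simp add: Q_def poly_profile poly_legendre_1 power_0_left)
  ultimately obtain r where r: "0 < r" "r < 1" "poly Q r = 0"
    using poly_IVT_neg[of 0 1 Q] by auto
  define Z where "Z = {t \<in> {0..1}. poly Q t = 0}"
  define a where "a = Min Z"
  have "Q \<noteq> 0" using Q1 by auto
  hence "finite Z" unfolding Z_def by (intro finite_subset[OF _ poly_roots_finite[of Q]]) auto
  moreover have "r \<in> Z" using r by (simp add: Z_def)
  ultimately have "a \<in> Z" and amin: "\<And>t. t \<in> Z \<Longrightarrow> a \<le> t"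
    unfolding a_def by (auto intro: Min_in)
  hence Qa: "poly Q a = 0" and a: "0 < a" "a < 1"
    using \<open>0 < poly Q 0\<close> Q1 by (auto simp: Z_def order.strict_iff_order)
  have Qpos': "0 < poly Q t" if "0 \<le> t" "t < a" for t
  proof (rule ccontr)
    assume "\<not> 0 < poly Q t"
    moreover from this have "t > 0" using that \<open>0 < poly Q 0\<close> by (cases "t = 0") auto
    moreover have "poly Q t \<noteq> 0" using that amin[of t] a by (auto simp: Z_def)
    ultimately obtain x where "0 < x" "x < t" "poly Q x = 0"
      using poly_IVT_neg[of 0 t Q] \<open>0 < poly Q 0\<close> by auto
    thus False using amin[of x] that a by (auto simp: Z_def)
  qed
  have even: "poly Q (- t) = poly Q t" for t by (simp add: Q_def poly_profile_minus)
  have Qpos: "0 < poly Q t" if "\<bar>t\<bar> < a" for t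
    using Qpos'[of "\<bar>t\<bar>"] that even[of t] by (auto simp: abs_if split: if_splits)
  from Qa obtain S where S: "Q = [:-a, 1:] * S" by (auto simp: poly_eq_0_iff_dvd)
  moreover have "poly Q (- a) = 0" using even Qa by simp
  ultimately have "poly S (- a) = 0" using a by (auto simp del: mult_pCons_left)
  then obtain S' where S': "S = [:a, 1:] * S'" by (auto simp: poly_eq_0_iff_dvd simp del: mult_pCons_left)
  define R where "R = - S'"
  have fac: "Q = [:a\<^sup>2, 0, -1:] * R"
  proof -
    have "Q = ([:-a, 1:] * [:a, 1:]) * S'" by (simp only: S S' mult.assoc)
    also have "[:-a, 1:] * [:a, 1:] = - [:a\<^sup>2, 0, -1:]" by (simp add: power2_eq_square)
    finally show ?thesis by (simp only: R_def minus_mult_minus mult_minus_left mult_minus_right)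
  qed
  have Qt: "poly Q t = (a\<^sup>2 - t\<^sup>2) * poly R t" for t
    by (simp add: fac power2_eq_square algebra_simps)
  have dQ: "poly (pderiv Q) t = - 2 * t * poly R t" if "\<bar>t\<bar> = a" for t
  proof -
    have "t * t = a\<^sup>2" using that by (auto simp: power2_eq_square)
    thus ?thesis
      by (simp only: fac pderiv_mult) (simp add: pderiv_pCons power2_eq_square algebra_simps)
  qed
  have Rpos': "0 < poly R t" if "\<bar>t\<bar> < a" for t
    using Qpos[OF that] that a by (simp add: Qt zero_less_mult_iff) (metis abs_of_pos abs_square_le_1 abs_le_square_iff less_le_not_le)
  have R0: "poly R t \<noteq> 0" if "\<bar>t\<bar> = a" for t
  proof -
    have "poly Q t = 0" using that Qa even[of a] by (auto simp: abs_if split: if_splits)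
    hence "poly (pderiv Q) t \<noteq> 0" unfolding Q_def using that a
      by (intro profile_deriv_nonzero_at_root assms) auto
    thus ?thesis using dQ[OF that] by auto
  qed
  \<comment> \<open>A negative value at \<plusminus>a would, with R(0) > 0, force a zero strictly
    between, where \<open>R\<close> is positive.\<close>
  have Rpos: "0 < poly R t" if "\<bar>t\<bar> \<le> a" for t
  proof (rule ccontr)
    assume *: "\<not> 0 < poly R t"
    hence t: "\<bar>t\<bar> = a" using Rpos'[of t] that by linarith
    with * R0 have "poly R t < 0" by (simp add: less_le)
    moreover have "0 < poly R 0" using Rpos'[of 0] a by simp
    ultimately obtain x where "min 0 t < x" "x < max 0 t" "poly R x = 0"
      using poly_IVT_neg[of 0 t R] poly_IVT_pos[of t 0 R] t a
      by (cases "t > 0") (auto simp: min_def max_def)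
    thus False using Rpos'[of x] t by (auto simp: min_def max_def split: if_splits)
  qed
  have "poly (pderiv Q) a < 0" using dQ[of a] Rpos[of a] a by simp
  hence neg': "poly Q t < 0" if "a < t" "t \<le> 1" for t
    using profile_sign_change[OF assms a(1) that] Qa by (simp add: Q_def)
  have neg: "poly Q t < 0" if "a < \<bar>t\<bar>" "\<bar>t\<bar> \<le> 1" for t
    using neg'[of "\<bar>t\<bar>"] that even[of t] by (auto simp: abs_if split: if_splits)
  have P0: "poly (legendre l) t \<noteq> 0" if "a \<le> t" "t \<le> 1" for t
  proof
    assume "poly (legendre l) t = 0"
    hence "poly Q t = (1 - t\<^sup>2) ^ l" by (simp add: Q_def poly_profile)
    moreover have "0 \<le> (1 - t\<^sup>2) ^ l" "t = a \<Longrightarrow> 0 < (1 - t\<^sup>2) ^ l"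
      using that a by (simp_all add: abs_square_le_1 abs_square_less_1 del: zero_le_power_eq zero_less_power_eq)
    moreover have "poly Q t \<le> 0 \<and> (t \<noteq> a \<longrightarrow> poly Q t < 0)"
      using neg'[of t] that Qa by (cases "t = a") auto
    ultimately show False by (cases "t = a") linarith+
  qed
  have "0 < poly (legendre l) t" if t: "a \<le> t" "t \<le> 1" for t
  proof (rule ccontr)
    assume "\<not> 0 < poly (legendre l) t"
    hence "poly (legendre l) t < 0" using P0[OF t] by linarith
    moreover from this have "t < 1" using t poly_legendre_1[of l] by (cases "t = 1") auto
    ultimately obtain x where "t < x" "x < 1" "poly (legendre l) x = 0"
      using poly_IVT_pos[of t 1 "legendre l"] by (auto simp: poly_legendre_1)
    thus False using P0[of x] t by auto
  qed
  thus thesis using that[OF a] fac Rpos neg unfolding Q_def by blast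
qed

section \<open>Parametrization of the nodal set\<close>

definition sphere_point :: "complex \<Rightarrow> real \<Rightarrow> real ^ 3" where
  "sphere_point z t = vector [Re z, Im z, t]"

definition horizontal :: "real ^ 3 \<Rightarrow> complex" where
  "horizontal x = Complex (x $ 1) (x $ 2)"

lemma horizontal_sphere_point [simp]: "horizontal (sphere_point z t) = z"
  by (simp add: horizontal_def sphere_point_def)

lemma sphere_point_3 [simp]: "sphere_point z t $ 3 = t"
  by (simp add: sphere_point_def)

lemma sphere_point_horizontal [simp]: "sphere_point (horizontal x) (x $ 3) = x"
  by (simp add: horizontal_def sphere_point_def vec_eq_iff forall_3)

lemma sphere_point_eq_iff [simp]: "sphere_point z t = sphere_point z' t' \<longleftrightarrow> z = z' \<and> t = t'"
  by (metis horizontal_sphere_point sphere_point_3)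

lemma in_unit_sphere_iff: "x \<in> unit_sphere \<longleftrightarrow> (cmod (horizontal x))\<^sup>2 + (x $ 3)\<^sup>2 = 1"
proof -
  have "(cmod (horizontal x))\<^sup>2 + (x $ 3)\<^sup>2 = (norm x)\<^sup>2"
    unfolding cmod_power2 power2_norm_eq_inner
    by (simp add: horizontal_def inner_vec_def sum_3 power2_eq_square)
  thus ?thesis using abs_square_eq_1[of "norm x"] by (simp add: unit_sphere_def)
qed

lemma H_harm_eq: "H_harm \<mu> l x = Im (horizontal x ^ l) + \<mu> * poly (legendre l) (x $ 3)"
  by (simp add: H_harm_def W_harm_def Z_harm_def horizontal_def)

section \<open>Smoothness from holomorphic extensions\<close>

lemma bounded_linear_sphere_point: "bounded_linear (\<lambda>(z, t). sphere_point z t)"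
proof -
  have "linear (\<lambda>(z, t). sphere_point z t)"
    by (rule linearI) (auto simp: sphere_point_def vec_eq_iff forall_3)
  thus ?thesis by (simp add: linear_conv_bounded_linear)
qed

lemma has_vector_derivative_sphere_point:
  assumes "(f has_vector_derivative f') (at t)" "(g has_vector_derivative g') (at t)"
  shows "((\<lambda>t. sphere_point (f t) (g t)) has_vector_derivative sphere_point f' g') (at t)"
  using bounded_linear.has_vector_derivative[OF bounded_linear_sphere_point
      has_vector_derivative_Pair[OF assms]] by simp

lemma has_vector_derivative_holomorphic_higher:
  assumes "f holomorphic_on S" "open S" "of_real t \<in> S"
  shows "((\<lambda>t. (deriv ^^ k) f (of_real t)) has_vector_derivative (deriv ^^ Suc k) f (of_real t)) (at t)"
proof -
  have "(deriv ^^ k) f holomorphic_on S" using assms by (intro holomorphic_higher_deriv)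
  hence "((deriv ^^ k) f has_field_derivative deriv ((deriv ^^ k) f) (of_real t)) (at (of_real t))"
    using assms(2,3) by (rule holomorphic_derivI)
  thus ?thesis by (simp add: has_vector_derivative_real_field)
qed

text \<open>Along the real axis the real derivative of a holomorphic function is its complex
  derivative, so the iterated complex derivatives supply the whole sequence required by
  \<open>smooth_curve\<close>.\<close>

lemma smooth_curve_holomorphic:
  assumes f: "f holomorphic_on S" "open S" "\<And>t. of_real t \<in> S"
    and g: "g holomorphic_on T" "open T" "\<And>t. of_real t \<in> T"
  shows "smooth_curve (\<lambda>t. sphere_point (f (of_real t)) (Re (g (of_real t))))"
  unfolding smooth_curve_def
proof (intro exI conjI allI)
  let ?d = "\<lambda>k t. sphere_point ((deriv ^^ k) f (of_real t)) (Re ((deriv ^^ k) g (of_real t)))"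
  show "?d 0 = (\<lambda>t. sphere_point (f (of_real t)) (Re (g (of_real t))))" by simp
  fix k t
  show "(?d k has_vector_derivative ?d (Suc k) t) (at t)"
    by (intro has_vector_derivative_sphere_point
        bounded_linear.has_vector_derivative[OF bounded_linear_Re]
        has_vector_derivative_holomorphic_higher[OF f]
        has_vector_derivative_holomorphic_higher[OF g])
qed

definition complex_poly :: "real poly \<Rightarrow> complex \<Rightarrow> complex" where
  "complex_poly p = poly (map_poly of_real p)"

lemma complex_poly_of_real [simp]: "complex_poly p (of_real x) = of_real (poly p x)"
  by (induction p) (simp_all add: complex_poly_def map_poly_pCons)

lemma holomorphic_on_complex_poly [holomorphic_intros]:
  assumes "f holomorphic_on S"
  shows "(\<lambda>x. complex_poly p (f x)) holomorphic_on S"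
  unfolding complex_poly_def poly_altdef by (intro holomorphic_intros assms)

text \<open>Collects what \<open>profile_factorization\<close> yields; from here on
  \<open>mu_crit\<close> enters only through these facts.\<close>

locale nodal_profile =
  fixes l :: nat and \<mu> a :: real and R :: "real poly"
  assumes l_pos: "l \<ge> 1" and mu_pos: "0 < \<mu>" and a_pos: "0 < a" and a_less_1: "a < 1"
    and profile_factor: "profile l \<mu> = [:a\<^sup>2, 0, -1:] * R"
    and R_pos: "\<And>t. \<bar>t\<bar> \<le> a \<Longrightarrow> 0 < poly R t"
    and profile_neg: "\<And>t. a < \<bar>t\<bar> \<Longrightarrow> \<bar>t\<bar> \<le> 1 \<Longrightarrow> poly (profile l \<mu>) t < 0"
    and legendre_pos: "\<And>t. a \<le> t \<Longrightarrow> t \<le> 1 \<Longrightarrow> 0 < poly (legendre l) t"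
begin

abbreviation P :: "real \<Rightarrow> real" where "P \<equiv> poly (legendre l)"

text \<open>\<open>winding\<close> is the number of times \<^term>\<open>horizontal x ^ l\<close> goes around \<open>0\<close> while the height
  oscillates once between \<open>a\<close> and \<open>-a\<close>.\<close>

definition winding :: nat where "winding = (if odd l then 1 else 0)"

text \<open>A square root of Q(a cos s) = a^2 sin^2 s R(a cos s) whose sign follows sin s, so that
  one period of \<open>s\<close> runs through both signs of Re(z^l).\<close>

definition root_fun :: "real \<Rightarrow> real" where
  "root_fun s = a * sin s * sqrt (poly R (a * cos s))"

definition wcurve :: "real \<Rightarrow> complex" where
  "wcurve s = Complex (root_fun s) (- \<mu> * P (a * cos s))"

text \<open>On the real axis this is i w(s) rotated back by exp(-i \<open>winding\<close> s). The
  rotation removes the winding, which keeps the values off the branch cut of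
  \<open>Ln\<close>.\<close>

definition unwound :: "complex \<Rightarrow> complex" where
  "unwound \<zeta> = (of_real \<mu> * complex_poly (legendre l) (of_real a * cos \<zeta>)
      + \<i> * of_real a * sin \<zeta> * csqrt (complex_poly R (of_real a * cos \<zeta>))) * exp (- \<i> * of_nat winding * \<zeta>)"

text \<open>The exponent is a logarithm of w divided by \<open>l\<close>: the summand -i pi / 2
  undoes the factor i in \<open>unwound\<close>, and the linear term restores the winding.\<close>

definition zcurve :: "complex \<Rightarrow> complex" where
  "zcurve \<zeta> = exp ((- \<i> * pi / 2 + \<i> * of_nat winding * \<zeta> + Ln (unwound \<zeta>)) / of_nat l)"

lemma abs_a_cos: "\<bar>a * cos s\<bar> \<le> a"
  using a_pos by (simp add: abs_mult)

lemma R_pos_cos: "0 < poly R (a * cos s)"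
  by (rule R_pos) (rule abs_a_cos)

lemma poly_profile_factor: "poly (profile l \<mu>) t = (a\<^sup>2 - t\<^sup>2) * poly R t"
  by (simp add: profile_factor power2_eq_square algebra_simps)

lemma unwound_of_real: "unwound (of_real s) = \<i> * wcurve s * cis (- (real winding * s))"
proof -
  have sq: "csqrt (of_real (poly R (a * cos s))) = of_real (sqrt (poly R (a * cos s)))"
    using R_pos_cos[of s] by simp
  have arg: "of_real a * cos (of_real s :: complex) = of_real (a * cos s)"
    by (simp add: cos_of_real)
  have ex: "exp (- \<i> * of_nat winding * of_real s) = cis (- (real winding * s))"
    by (simp add: cis_conv_exp mult.assoc)
  have "unwound (of_real s) = (of_real (\<mu> * P (a * cos s)) + \<i> * of_real (root_fun s))
      * cis (- (real winding * s))"
    unfolding unwound_def arg complex_poly_of_real sq ex sin_of_real root_fun_def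
    by (simp add: mult.assoc)
  also have "of_real (\<mu> * P (a * cos s)) + \<i> * of_real (root_fun s) = \<i> * wcurve s"
    by (simp add: wcurve_def complex_eq_iff)
  finally show ?thesis .
qed

lemma poly_legendre_cases:
  "sin s = 0 \<Longrightarrow> P (a * cos s) = (if even l then P a else cos s * P a)"
proof -
  assume "sin s = 0"
  hence "cos s = 1 \<or> cos s = - 1" using sin_zero_abs_cos_one by fastforce
  thus ?thesis by (auto simp: poly_legendre_minus)
qed

text \<open>For even \<open>l\<close> the value is real only where sin s = 0, and there it is \<mu>
  P_l(a) > 0. For odd \<open>l\<close> the imaginary part is sin s (a r cos s - p): if sin s = 0 the
  real part is again \<mu> P_l(a), and if p = a r cos s it is a r.\<close>

lemma unwound_not_nonpos: "unwound (of_real s) \<notin> \<real>\<^sub>\<le>\<^sub>0"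
proof
  assume nonpos: "unwound (of_real s) \<in> \<real>\<^sub>\<le>\<^sub>0"
  define r where "r = sqrt (poly R (a * cos s))"
  define p where "p = \<mu> * P (a * cos s)"
  have r: "0 < r" using R_pos_cos by (simp add: r_def)
  have Pa: "0 < \<mu> * P a" using legendre_pos[of a] mu_pos a_less_1 by simp
  have sq: "sin s = 0 \<Longrightarrow> cos s * cos s = 1" 
    using sin_cos_squared_add[of s] by (simp add: power2_eq_square)
  have u: "unwound (of_real s) = Complex p (a * sin s * r) * cis (- (real winding * s))"
    unfolding unwound_of_real
    by (simp add: wcurve_def root_fun_def p_def r_def complex_eq_iff)
  show False
  proof (cases "even l")
    case True
    hence u: "unwound (of_real s) = Complex p (a * sin s * r)" by (simp add: u winding_def)
    with nonpos have "sin s = 0" "p \<le> 0"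
      using r a_pos by (auto simp: complex_nonpos_Reals_iff)
    thus False using True Pa poly_legendre_cases[of s] by (simp add: p_def)
  next
    case False
    hence "Re (unwound (of_real s)) = p * cos s + a * (sin s * sin s) * r"
      "Im (unwound (of_real s)) = sin s * (a * r * cos s - p)"
      by (simp_all add: u winding_def algebra_simps)
    with nonpos have *: "p * cos s + a * (sin s * sin s) * r \<le> 0"
      and "sin s = 0 \<or> p = a * r * cos s"
      by (auto simp: complex_nonpos_Reals_iff)
    from this(2) show False
    proof
      assume s: "sin s = 0"
      have "p * cos s = \<mu> * P a * (cos s * cos s)"
        using poly_legendre_cases[OF s] False by (simp add: p_def)
      thus False using * s Pa sq by simp
    next
      assume p: "p = a * r * cos s"
      have "p * cos s + a * (sin s * sin s) * r = a * r * ((sin s)\<^sup>2 + (cos s)\<^sup>2)"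
        unfolding p by (simp only: power2_eq_square algebra_simps)
      thus False using * r a_pos by (simp add: mult_le_0_iff)
    qed
  qed
qed

lemma wcurve_nonzero: "wcurve s \<noteq> 0"
  using unwound_not_nonpos[of s] by (auto simp: unwound_of_real)

lemma zcurve_power: "zcurve (of_real s) ^ l = wcurve s"
proof -
  have "zcurve (of_real s) ^ l
      = exp (- \<i> * pi / 2 + \<i> * of_nat winding * of_real s + Ln (unwound (of_real s)))"
    using l_pos by (simp add: zcurve_def flip: exp_of_nat_mult)
  also have "\<dots> = cis (- (pi / 2)) * cis (real winding * s) * unwound (of_real s)"
  proof -
    have nz: "unwound (of_real s) \<noteq> 0" using unwound_not_nonpos[of s] by auto
    have "exp (- \<i> * pi / 2) = cis (- (pi / 2))"
      "exp (\<i> * of_nat winding * of_real s) = cis (real winding * s)"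
      by (simp_all add: cis_conv_exp mult.assoc)
    thus ?thesis by (simp only: exp_add exp_Ln[OF nz])
  qed
  also have "\<dots> = cis (- (pi / 2)) * \<i> * wcurve s * (cis (real winding * s) * cis (- (real winding * s)))"
    by (simp only: unwound_of_real mult_ac)
  also have "\<dots> = wcurve s" by (simp add: cis_mult complex_eq_iff)
  finally show ?thesis .
qed

lemma cmod_wcurve: "(cmod (wcurve s))\<^sup>2 = (1 - (a * cos s)\<^sup>2) ^ l"
proof -
  have "a\<^sup>2 * (sin s)\<^sup>2 = a\<^sup>2 - (a * cos s)\<^sup>2"
    by (simp add: sin_squared_eq power_mult_distrib algebra_simps)
  hence "(root_fun s)\<^sup>2 = poly (profile l \<mu>) (a * cos s)"
    using R_pos_cos[of s] by (simp add: root_fun_def power_mult_distrib poly_profile_factor less_imp_le)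
  thus ?thesis
    by (simp add: wcurve_def cmod_power2 poly_profile)
qed

lemma cmod_zcurve: "(cmod (zcurve (of_real s)))\<^sup>2 = 1 - (a * cos s)\<^sup>2"
proof (rule power_eq_imp_eq_base)
  show "((cmod (zcurve (of_real s)))\<^sup>2) ^ l = (1 - (a * cos s)\<^sup>2) ^ l"
    using cmod_wcurve[of s]
    by (simp only: zcurve_power[symmetric] norm_power) (simp add: mult.commute flip: power_mult)
  show "0 \<le> 1 - (a * cos s)\<^sup>2"
    using abs_a_cos[of s] a_less_1 by (simp add: abs_square_le_1)
qed (use l_pos in auto)

lemma unwound_shift:
  fixes j :: int
  shows "unwound (of_real (s + 2 * pi * j)) = unwound (of_real s)"
proof -
  have sc: "sin (s + 2 * pi * j) = sin s" "cos (s + 2 * pi * j) = cos s"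
    using sin_cos_eq_iff[of "s + 2 * pi * j" s] by auto
  have "cis (- (real winding * (s + 2 * pi * j))) = cis (- (real winding * s))"
    by (auto simp: winding_def cis.ctr sc)
  thus ?thesis by (simp only: unwound_of_real wcurve_def root_fun_def sc)
qed

text \<open>The monodromy of the root: \<open>unwound\<close> is periodic, so only the linear term
  of the exponent changes. A single period gives the factor 1 for even \<open>l\<close> and a
  primitive \<open>l\<close>-th root of unity for odd \<open>l\<close>.\<close>

lemma zcurve_shift:
  fixes j :: int
  shows "zcurve (of_real (s + 2 * pi * j)) = cis (2 * pi * winding * j / l) * zcurve (of_real s)"
  unfolding zcurve_def unwound_shift cis_conv_exp exp_add[symmetric]
  using l_pos by (intro arg_cong[where f = exp]) (simp add: field_simps)

text \<open>Equal heights give equal cosines. The \<open>l\<close>-th power removes the roots of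
  unity and gives w(s) = w(s'), hence equal sines; the parameters then differ by whole periods and
  the monodromy compares the roots of unity.\<close>

lemma zcurve_sphere_point_eqD:
  assumes "\<omega> * zcurve (of_real s) = \<omega>' * zcurve (of_real s')" "a * cos s = a * cos s'"
    and "\<omega> ^ l = 1" "\<omega>' ^ l = 1"
  obtains j :: int where "s = s' + 2 * pi * j" "\<omega>' = \<omega> * cis (2 * pi * winding * j / l)"
proof -
  have c: "cos s = cos s'" using assms(2) a_pos by simp
  have "wcurve s = (\<omega> * zcurve (of_real s)) ^ l" by (simp add: power_mult_distrib assms(3) zcurve_power)
  also have "\<dots> = wcurve s'"
    unfolding assms(1) by (simp add: power_mult_distrib assms(4) zcurve_power)
  finally have "sin s = sin s'"
    using c R_pos_cos[of s'] a_pos by (simp add: wcurve_def root_fun_def)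
  then obtain j :: int where j: "s = s' + 2 * pi * j" using c sin_cos_eq_iff[of s s'] by auto
  have "zcurve (of_real s') \<noteq> 0" by (simp add: zcurve_def)
  moreover have "\<omega> * cis (2 * pi * winding * j / l) * zcurve (of_real s') = \<omega>' * zcurve (of_real s')"
    using assms(1) unfolding j zcurve_shift by (simp only: mult.assoc)
  ultimately have "\<omega> * cis (2 * pi * winding * j / l) = \<omega>'"
    by (simp only: mult_cancel_right) simp
  with j show thesis by (intro that) auto
qed

definition point :: "complex \<Rightarrow> real \<Rightarrow> real ^ 3" where
  "point \<omega> s = sphere_point (\<omega> * zcurve (of_real s)) (a * cos s)"

lemma H_harm_point: "\<omega> ^ l = 1 \<Longrightarrow> H_harm \<mu> l (point \<omega> s) = 0"
  by (simp add: point_def H_harm_eq power_mult_distrib zcurve_power wcurve_def)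

lemma point_in_nodal_set: 
  assumes "\<omega> ^ l = 1"
  shows "point \<omega> s \<in> nodal_set (H_harm \<mu> l)"
proof -
  have "norm \<omega> = 1" using power_eq_1_iff[OF assms] l_pos by simp
  hence "point \<omega> s \<in> unit_sphere"
    by (simp add: point_def in_unit_sphere_iff norm_mult power_mult_distrib[of "norm \<omega>"] cmod_zcurve)
  thus ?thesis using H_harm_point[OF assms] by (simp add: nodal_set_def)
qed

text \<open>Q(t) = Re(z^l)^2 is nonnegative, so t = a cos s for some \<open>s\<close>. Once z^l =
  w(s), dividing \<open>z\<close> by the chosen root of w(s) leaves a root of unity.\<close>

lemma nodal_setE:
  assumes "x \<in> nodal_set (H_harm \<mu> l)"
  obtains \<omega> s where "\<omega> ^ l = 1" "x = point \<omega> s"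
proof -
  define z where "z = horizontal x"
  define t where "t = x $ 3"
  have S: "(cmod z)\<^sup>2 = 1 - t\<^sup>2" and H: "Im (z ^ l) = - \<mu> * P t"
    using assms by (auto simp: nodal_set_def in_unit_sphere_iff H_harm_eq z_def t_def)
  have "(cmod (z ^ l))\<^sup>2 = (1 - t\<^sup>2) ^ l"
    unfolding norm_power S[symmetric] by (simp add: mult.commute flip: power_mult)
  hence Re: "(Re (z ^ l))\<^sup>2 = poly (profile l \<mu>) t"
    using H by (simp add: cmod_power2 poly_profile)
  have "\<bar>t\<bar> \<le> 1" using S zero_le_power2[of "cmod z"] by (simp add: abs_square_le_1)
  moreover have "0 \<le> poly (profile l \<mu>) t" unfolding Re[symmetric] by simp
  ultimately have t: "\<bar>t\<bar> \<le> a" using profile_neg[of t] by linarith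
  define s0 where "s0 = arccos (t / a)"
  have "\<bar>t / a\<bar> \<le> 1" using t a_pos by simp
  hence s0: "a * cos s0 = t" "0 \<le> sin s0"
    using a_pos by (auto simp: s0_def cos_arccos_abs sin_arccos_abs abs_square_le_1)
  \<comment> \<open>Negating the parameter keeps the height and flips \<open>root_fun\<close>, so
    its sign can be matched to that of Re(z^l).\<close>
  define s where "s = (if 0 \<le> Re (z ^ l) then s0 else - s0)"
  have s: "a * cos s = t" using s0 by (simp add: s_def)
  have sgn: "0 \<le> Re (z ^ l) \<and> 0 \<le> root_fun s \<or> Re (z ^ l) \<le> 0 \<and> root_fun s \<le> 0"
    using s0 a_pos R_pos_cos[of s] 
    by (auto simp: s_def root_fun_def mult_le_0_iff zero_le_mult_iff)
  have "(root_fun s)\<^sup>2 + (\<mu> * P t)\<^sup>2 = (1 - t\<^sup>2) ^ l"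
    using cmod_wcurve[of s] by (simp add: wcurve_def cmod_power2 s)
  hence "(Re (z ^ l))\<^sup>2 = (root_fun s)\<^sup>2" using Re by (simp add: poly_profile)
  hence "Re (z ^ l) = root_fun s" using sgn by (auto simp: power2_eq_iff)
  hence zl: "z ^ l = wcurve s" using H by (simp add: wcurve_def complex_eq_iff s)
  have nz: "zcurve (of_real s) \<noteq> 0" by (simp add: zcurve_def)
  have "(z / zcurve (of_real s)) ^ l = 1"
    using zl by (simp add: power_divide zcurve_power wcurve_nonzero)
  moreover have "x = point (z / zcurve (of_real s)) s"
    using nz by (simp add: point_def s) (simp add: z_def t_def)
  ultimately show thesis by (rule that)
qed

text \<open>The domain consists of the points where the arguments of \<open>csqrt\<close> and
  \<open>Ln\<close> avoid their branch cuts; \<open>R_pos_cos\<close> and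
  \<open>unwound_not_nonpos\<close> place the real axis in it.\<close>

lemma zcurve_holomorphic:
  obtains S where "open S" "zcurve holomorphic_on S" "\<And>s. of_real s \<in> S"
proof -
  define q where "q \<zeta> = complex_poly R (of_real a * cos \<zeta>)" for \<zeta>
  define S1 where "S1 = q -` (- \<real>\<^sub>\<le>\<^sub>0)"
  define S where "S = S1 \<inter> unwound -` (- \<real>\<^sub>\<le>\<^sub>0)"
  have q: "q holomorphic_on A" for A unfolding q_def by (intro holomorphic_intros)
  have S1: "open S1" unfolding S1_def
    by (rule open_vimage) (use q[of UNIV] in \<open>auto simp: holomorphic_on_imp_continuous_on\<close>)
  have u: "unwound holomorphic_on S1"
    unfolding unwound_def q_def[symmetric]
    by (intro holomorphic_intros q) (auto simp: S1_def)
  have "open S" unfolding S_def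
    by (rule continuous_open_preimage[OF holomorphic_on_imp_continuous_on[OF u] S1]) auto
  moreover have "zcurve holomorphic_on S"
    unfolding zcurve_def
    using l_pos by (intro holomorphic_intros holomorphic_on_subset[OF u]) (auto simp: S_def)
  moreover have "of_real s \<in> S" for s
  proof -
    have "q (of_real s) = of_real (poly R (a * cos s))"
      unfolding q_def by (simp flip: complex_poly_of_real add: cos_of_real)
    thus ?thesis using R_pos_cos[of s] unwound_not_nonpos[of s] by (simp add: S_def S1_def)
  qed
  ultimately show thesis by (rule that)
qed

text \<open>The speed \<open>m\<close> is 1 for even \<open>l\<close> and \<open>l\<close> for odd
  \<open>l\<close>, where the curve closes only after \<open>l\<close> periods of the
  height.\<close>

lemma smooth_curve_point: "smooth_curve (\<lambda>\<tau>. point \<omega> (m * \<tau>))"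
proof -
  obtain S where S: "open S" "zcurve holomorphic_on S" "\<And>s. of_real s \<in> S"
    using zcurve_holomorphic by blast
  let ?S = "(\<lambda>\<zeta>. of_real m * \<zeta>) -` S"
  let ?f = "\<lambda>\<zeta>. \<omega> * zcurve (of_real m * \<zeta>)" and ?g = "\<lambda>\<zeta>. of_real a * cos (of_real m * \<zeta>)"
  have "smooth_curve (\<lambda>\<tau>. sphere_point (?f (of_real \<tau>)) (Re (?g (of_real \<tau>))))"
  proof (rule smooth_curve_holomorphic[where f = ?f and g = ?g and S = ?S and T = UNIV])
    show "open ?S" by (intro open_vimage S continuous_intros)
    show "?f holomorphic_on ?S"
      by (intro holomorphic_on_mult holomorphic_on_const
          holomorphic_on_compose_gen[OF _ S(2), where f = "\<lambda>\<zeta>. of_real m * \<zeta>", unfolded o_def])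
         (auto intro: holomorphic_intros)
    show "of_real t \<in> ?S" for t using S(3)[of "m * t"] by simp
    show "?g holomorphic_on UNIV" by (intro holomorphic_intros)
  qed auto
  moreover have "sphere_point (?f (of_real \<tau>)) (Re (?g (of_real \<tau>))) = point \<omega> (m * \<tau>)" for \<tau>
    by (simp add: point_def cos_of_real flip: of_real_mult)
  ultimately show ?thesis by simp
qed

text \<open>If the velocity vanished, so would the derivatives of the height \<open>a * cos s\<close> and of
  \<open>Re (horizontal x ^ l) = root_fun s\<close>; but \<open>root_fun\<close> has simple zeros where \<open>sin\<close> vanishes.\<close>

lemma vector_derivative_point:
  assumes "\<omega> ^ l = 1" "m \<noteq> 0"
  shows "vector_derivative (\<lambda>\<tau>. point \<omega> (m * \<tau>)) (at \<tau>) \<noteq> 0"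
proof
  let ?\<gamma> = "\<lambda>\<tau>. point \<omega> (m * \<tau>)"
  assume "vector_derivative ?\<gamma> (at \<tau>) = 0"
  moreover have "(?\<gamma> has_vector_derivative vector_derivative ?\<gamma> (at \<tau>)) (at \<tau>)"
  proof -
    obtain d where "d 0 = ?\<gamma>" "\<And>k t. (d k has_vector_derivative d (Suc k) t) (at t)"
      using smooth_curve_point[of \<omega> m] unfolding smooth_curve_def by blast
    hence "(?\<gamma> has_vector_derivative d 1 \<tau>) (at \<tau>)" by (metis One_nat_def)
    thus ?thesis by (metis vector_derivative_at)
  qed
  ultimately have d0: "(?\<gamma> has_vector_derivative 0) (at \<tau>)" by simp
  have "((\<lambda>\<tau>. vec_nth (?\<gamma> \<tau>) 3) has_vector_derivative vec_nth (0 :: real ^ 3) 3) (at \<tau>)"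
    by (rule bounded_linear.has_vector_derivative[OF bounded_linear_vec_nth d0])
  hence "((\<lambda>\<tau>. a * cos (m * \<tau>)) has_field_derivative 0) (at \<tau>)"
    by (simp add: point_def has_real_derivative_iff_has_vector_derivative)
  moreover have "((\<lambda>\<tau>. a * cos (m * \<tau>)) has_field_derivative - a * m * sin (m * \<tau>)) (at \<tau>)"
    by (auto intro!: derivative_eq_intros)
  ultimately have "- a * m * sin (m * \<tau>) = 0" by (rule DERIV_unique[symmetric])
  hence sin: "sin (m * \<tau>) = 0" using a_pos assms by simp
  have lin: "bounded_linear horizontal"
  proof -
    have "linear horizontal" by (rule linearI) (auto simp: horizontal_def complex_eq_iff)
    thus ?thesis by (simp add: linear_conv_bounded_linear)
  qed
  have "((\<lambda>\<tau>. horizontal (?\<gamma> \<tau>)) has_vector_derivative horizontal 0) (at \<tau>)"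
    by (rule bounded_linear.has_vector_derivative[OF lin d0])
  hence h: "((\<lambda>\<tau>. horizontal (?\<gamma> \<tau>)) has_vector_derivative 0) (at \<tau>)"
    by (simp add: linear_0[OF bounded_linear.linear[OF lin]])
  have "((\<lambda>z. z ^ l) has_field_derivative of_nat l * horizontal (?\<gamma> \<tau>) ^ (l - 1)) (at (horizontal (?\<gamma> \<tau>)))"
    by (auto intro!: derivative_eq_intros)
  from field_vector_diff_chain_at[OF h this]
  have "((\<lambda>\<tau>. horizontal (?\<gamma> \<tau>) ^ l) has_vector_derivative 0) (at \<tau>)" by (simp add: o_def)
  from bounded_linear.has_vector_derivative[OF bounded_linear_Re this]
  have "((\<lambda>\<tau>. Re (horizontal (?\<gamma> \<tau>) ^ l)) has_field_derivative 0) (at \<tau>)"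
    by (simp add: has_real_derivative_iff_has_vector_derivative)
  moreover have "Re (horizontal (?\<gamma> \<tau>) ^ l) = root_fun (m * \<tau>)" for \<tau>
    by (simp add: point_def power_mult_distrib assms zcurve_power wcurve_def del: of_real_mult)
  ultimately have "((\<lambda>\<tau>. root_fun (m * \<tau>)) has_field_derivative 0) (at \<tau>)"
    by simp
  \<comment> \<open>The term containing the derivative of the square root carries the factor sin(m
    \<tau>), which is 0 here.\<close>
  moreover have "((\<lambda>\<tau>. root_fun (m * \<tau>)) has_field_derivative
      a * m * cos (m * \<tau>) * sqrt (poly R (a * cos (m * \<tau>)))) (at \<tau>)"
    unfolding root_fun_def using R_pos_cos[of "m * \<tau>"]
    by (auto intro!: derivative_eq_intros DERIV_chain2[OF poly_DERIV] simp: sin)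
  ultimately have "a * m * cos (m * \<tau>) * sqrt (poly R (a * cos (m * \<tau>))) = 0"
    by (rule DERIV_unique[symmetric])
  hence "cos (m * \<tau>) = 0" using a_pos assms R_pos_cos[of "m * \<tau>"] by auto
  thus False using sin sin_cos_squared_add[of "m * \<tau>"] by simp
qed

text \<open>The monodromy generates the \<open>l\<close>-th roots of unity, so all branches are
  shifts of the branch with root 1, which closes up after exactly \<open>l\<close> periods.\<close>

lemma nodal_set_odd:
  assumes "odd l"
  shows "regular_simple_closed_curve (nodal_set (H_harm \<mu> l))"
  unfolding regular_simple_closed_curve_def
proof (intro exI conjI allI)
  let ?\<gamma> = "\<lambda>\<tau>. point 1 (real l * \<tau>)"
  have w: "winding = 1" using assms by (simp add: winding_def)
  show "smooth_curve ?\<gamma>" by (rule smooth_curve_point)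
  show "vector_derivative ?\<gamma> (at t) \<noteq> 0" for t
    using l_pos by (intro vector_derivative_point) auto
  show "?\<gamma> (t + 2 * pi) = ?\<gamma> t" for t
  proof -
    have "real l * (t + 2 * pi) = real l * t + 2 * pi * int l" by (simp add: algebra_simps)
    moreover have "cos (real l * t + 2 * pi * int l) = cos (real l * t)"
      using sin_cos_eq_iff by blast
    moreover have "cis (2 * pi * winding * int l / l) = 1" using l_pos by (simp add: w)
    ultimately show ?thesis
      unfolding point_def by (simp only: zcurve_shift) simp
  qed
  show "inj_on ?\<gamma> {0..<2 * pi}"
  proof (rule inj_onI)
    fix x y assume xy: "x \<in> {0..<2 * pi}" "y \<in> {0..<2 * pi}" "?\<gamma> x = ?\<gamma> y"
    from xy(3) obtain j :: int where j: "real l * x = real l * y + 2 * pi * j"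
      "1 = 1 * cis (2 * pi * winding * j / l)"
      using zcurve_sphere_point_eqD[of 1 "real l * x" 1 "real l * y"] by (auto simp: point_def)
    \<comment> \<open>Trivial monodromy after \<open>j\<close> periods means that \<open>l\<close>
      divides \<open>j\<close>.\<close>
    from j(2) have "cos (2 * pi * j / l) = 1" by (simp add: w complex_eq_iff)
    then obtain i :: int where "2 * pi * j / l = i * 2 * pi" using cos_one_2pi_int by auto
    hence "real_of_int j = l * i" using l_pos by (simp add: field_simps)
    hence "real l * x = real l * (y + 2 * pi * i)" by (simp only: j(1)) (simp add: algebra_simps)
    hence "x - y = 2 * pi * i" using l_pos by simp
    moreover have "\<bar>x - y\<bar> < 2 * pi" using xy by auto
    ultimately have "\<bar>real_of_int i\<bar> < 1" by (simp add: abs_mult)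
    hence "i = 0" by linarith
    thus "x = y" using \<open>x - y = 2 * pi * i\<close> by simp
  qed
  show "nodal_set (H_harm \<mu> l) = range ?\<gamma>"
  proof
    show "range ?\<gamma> \<subseteq> nodal_set (H_harm \<mu> l)" using point_in_nodal_set[of 1] by auto
    show "nodal_set (H_harm \<mu> l) \<subseteq> range ?\<gamma>"
    proof
      fix x assume "x \<in> nodal_set (H_harm \<mu> l)"
      then obtain \<omega> s where \<omega>: "\<omega> ^ l = 1" "x = point \<omega> s" by (rule nodal_setE)
      from \<omega>(1) obtain k where k: "\<omega> = cis (2 * pi * real k / real l)"
        using Complex.bij_betw_roots_unity[of l] l_pos
        by (auto simp: bij_betw_def set_eq_iff image_iff)
      have "cos (s + 2 * pi * int k) = cos s"
        using sin_cos_eq_iff by blast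
      hence "x = point 1 (s + 2 * pi * int k)"
        by (simp only: \<omega>(2) k point_def zcurve_shift) (simp add: w)
      also have "\<dots> = ?\<gamma> ((s + 2 * pi * int k) / l)" using l_pos by simp
      finally show "x \<in> range ?\<gamma>" by blast
    qed
  qed
qed

text \<open>With trivial monodromy each root of unity labels its own closed curve, and a common
  point of two curves forces equal labels.\<close>

lemma nodal_set_even:
  assumes "even l"
  shows "\<exists>\<C>. card \<C> = l \<and> disjoint \<C> \<and> (\<forall>C\<in>\<C>. regular_simple_closed_curve C) \<and>
           nodal_set (H_harm \<mu> l) = \<Union>\<C>"
proof -
  define \<Omega> where "\<Omega> = {\<omega>::complex. \<omega> ^ l = 1}"
  have w: "winding = 0" using assms by (simp add: winding_def)
  have eqD: "\<exists>j::int. s = s' + 2 * pi * j \<and> \<omega>' = \<omega>"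
    if "point \<omega> s = point \<omega>' s'" "\<omega> \<in> \<Omega>" "\<omega>' \<in> \<Omega>" for \<omega> \<omega>' s s'
    using zcurve_sphere_point_eqD[of \<omega> s \<omega>' s'] that by (auto simp: point_def \<Omega>_def w)
  have disj: "range (point \<omega>) \<inter> range (point \<omega>') = {}" if "\<omega> \<in> \<Omega>" "\<omega>' \<in> \<Omega>" "\<omega> \<noteq> \<omega>'" for \<omega> \<omega>'
    using eqD that by blast
  have "inj_on (\<lambda>\<omega>. range (point \<omega>)) \<Omega>"
    by (rule inj_onI) (use disj in blast)
  hence "card ((\<lambda>\<omega>. range (point \<omega>)) ` \<Omega>) = l"
    using card_roots_unity_eq[of l] l_pos by (simp add: card_image \<Omega>_def)
  moreover have "disjoint ((\<lambda>\<omega>. range (point \<omega>)) ` \<Omega>)"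
    unfolding pairwise_def disjnt_def using disj by blast
  moreover have "regular_simple_closed_curve (range (point \<omega>))" if \<omega>: "\<omega> \<in> \<Omega>" for \<omega>
    unfolding regular_simple_closed_curve_def
  proof (intro exI[of _ "point \<omega>"] conjI allI)
    show "smooth_curve (point \<omega>)" using smooth_curve_point[of \<omega> 1] by simp
    show "vector_derivative (point \<omega>) (at t) \<noteq> 0" for t
      using vector_derivative_point[of \<omega> 1 t] \<omega> by (simp add: \<Omega>_def)
    show "point \<omega> (t + 2 * pi) = point \<omega> t" for t
      using zcurve_shift[of t 1] by (simp add: point_def w)
    show "inj_on (point \<omega>) {0..<2 * pi}"
    proof (rule inj_onI)
      fix x y assume xy: "x \<in> {0..<2 * pi}" "y \<in> {0..<2 * pi}" "point \<omega> x = point \<omega> y"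
      with eqD \<omega> obtain j :: int where j: "x = y + 2 * pi * j" by blast
      moreover have "\<bar>x - y\<bar> < 2 * pi" using xy by auto
      ultimately have "\<bar>real_of_int j\<bar> < 1" by (simp add: abs_mult)
      hence "j = 0" by linarith
      thus "x = y" using j by simp
    qed
  qed simp
  moreover have "nodal_set (H_harm \<mu> l) = \<Union> ((\<lambda>\<omega>. range (point \<omega>)) ` \<Omega>)"
    using point_in_nodal_set by (auto simp: \<Omega>_def elim!: nodal_setE)
  ultimately show ?thesis by (intro exI[of _ "(\<lambda>\<omega>. range (point \<omega>)) ` \<Omega>"]) auto
qed

end

section \<open>Nodal domains\<close>

text \<open>A continuous function with finitely many values is constant on connected sets, and
  \<open>r\<close> provides a point joined to every point of the same value; the components are thus
  the level sets of \<open>F\<close>.\<close>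

lemma card_components_eq_card_invariant:
  fixes F :: "'a::topological_space \<Rightarrow> 'b::real_normed_algebra_1"
  assumes "finite V" "continuous_on X F" "\<And>x. x \<in> X \<Longrightarrow> F x \<in> V"
    and r: "\<And>v. v \<in> V \<Longrightarrow> r v \<in> X" "\<And>v. v \<in> V \<Longrightarrow> F (r v) = v"
    and conn: "\<And>x. x \<in> X \<Longrightarrow> connected_component X x (r (F x))"
  shows "card (components X) = card V"
proof -
  have const: "F x = F y" if "connected_component X x y" for x y
  proof -
    obtain T where T: "connected T" "T \<subseteq> X" "x \<in> T" "y \<in> T"
      using \<open>connected_component X x y\<close> by (auto simp: connected_component_def)
    have "finite (F ` T)"
      by (rule finite_subset[OF _ assms(1)]) (use T assms(3) in auto)
    hence "F constant_on T"
      using T continuous_on_subset[OF assms(2)] by (intro continuous_finite_range_constant)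
    thus ?thesis using T by (auto simp: constant_on_def)
  qed
  have "bij_betw (\<lambda>v. connected_component_set X (r v)) V (components X)"
    unfolding bij_betw_def
  proof
    show "inj_on (\<lambda>v. connected_component_set X (r v)) V"
    proof (rule inj_onI)
      fix v w assume vw: "v \<in> V" "w \<in> V"
        "connected_component_set X (r v) = connected_component_set X (r w)"
      hence "connected_component X (r v) (r w)"
        using r(1)[of w] by (metis connected_component_refl mem_Collect_eq)
      from const[OF this] show "v = w" using vw r by simp
    qed
    show "(\<lambda>v. connected_component_set X (r v)) ` V = components X"
    proof
      show "(\<lambda>v. connected_component_set X (r v)) ` V \<subseteq> components X"
        using r by (auto simp: components_def)
      show "components X \<subseteq> (\<lambda>v. connected_component_set X (r v)) ` V"
      proof
        fix C assume "C \<in> components X"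
        then obtain x where x: "x \<in> X" "C = connected_component_set X x"
          by (auto simp: components_def)
        hence "C = connected_component_set X (r (F x))"
          using connected_component_eq[of "r (F x)" X x] conn[OF x(1)] by simp
        thus "C \<in> (\<lambda>v. connected_component_set X (r v)) ` V" using x assms(3) by blast
      qed
    qed
  qed
  thus ?thesis by (simp add: bij_betw_same_card)
qed

text \<open>Since \<open>h\<close> has no zero, both sign sets are open in \<open>X\<close>, and the
  two pieces glue without a matching condition.\<close>

lemma continuous_on_sign_cases:
  fixes h :: "'a::topological_space \<Rightarrow> real"
  assumes h: "continuous_on X h" "\<And>x. x \<in> X \<Longrightarrow> h x \<noteq> 0"
    and f: "continuous_on {x \<in> X. 0 < h x} f" and g: "continuous_on {x \<in> X. h x < 0} g"
  shows "continuous_on X (\<lambda>x. if 0 < h x then f x else g x)"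
proof -
  have X: "X = {x \<in> X. 0 < h x} \<union> {x \<in> X. h x < 0}"
    using h(2) by (auto simp: neq_iff)
  have "{x \<in> X. 0 < h x} = X \<inter> h -` {0<..}" "{x \<in> X. h x < 0} = X \<inter> h -` {..<0}" by auto
  hence "openin (top_of_set X) {x \<in> X. 0 < h x}" "openin (top_of_set X) {x \<in> X. h x < 0}"
    using continuous_openin_preimage_gen[OF h(1)] by simp_all
  hence "continuous_on ({x \<in> X. 0 < h x} \<union> {x \<in> X. h x < 0}) (\<lambda>x. if 0 < h x then f x else g x)"
    using X f g by (intro continuous_on_cases_local_open) auto
  thus ?thesis using X by simp
qed

lemma connected_component_path_image:
  fixes c :: "real \<Rightarrow> 'a::topological_space"
  assumes "continuous_on {u..v} c" "u \<le> v" "\<And>s. u \<le> s \<Longrightarrow> s \<le> v \<Longrightarrow> c s \<in> X"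
  shows "connected_component X (c u) (c v)"
  unfolding connected_component_def
  by (rule exI[of _ "c ` {u..v}"]) (use assms in \<open>auto intro!: connected_continuous_image\<close>)

section \<open>Spherical coordinates and motion along parallels\<close>

lemma spherical_coords_eq: "spherical_coords \<theta> \<phi> = sphere_point (of_real (sin \<theta>) * cis \<phi>) (cos \<theta>)"
  by (simp add: spherical_coords_def sphere_point_def)

lemma continuous_on_spherical_coords [continuous_intros]:
  fixes f g :: "'a::t2_space \<Rightarrow> real"
  assumes "continuous_on A f" "continuous_on A g"
  shows "continuous_on A (\<lambda>x. spherical_coords (f x) (g x))"
proof -
  have "continuous_on A (\<lambda>x. (complex_of_real (sin (f x)) * cis (g x), cos (f x)))"
    by (intro continuous_intros assms)
  from bounded_linear.continuous_on[OF bounded_linear_sphere_point this]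
  show ?thesis by (simp add: spherical_coords_eq)
qed

lemma unit_sphere_spherical_coords:
  assumes "x \<in> unit_sphere"
  obtains \<theta> \<phi> where "0 \<le> \<theta>" "\<theta> \<le> pi" "x = spherical_coords \<theta> \<phi>"
proof -
  define z t where "z = horizontal x" and "t = x $ 3"
  have S: "(cmod z)\<^sup>2 = 1 - t\<^sup>2"
    using assms by (simp add: in_unit_sphere_iff z_def t_def)
  have t: "\<bar>t\<bar> \<le> 1" using S zero_le_power2[of "cmod z"] by (simp add: abs_square_le_1)
  have "sin (arccos t) = cmod z"
    using t S by (simp add: sin_arccos_abs flip: S)
  hence "of_real (sin (arccos t)) * cis (Arg z) = z"
    using rcis_cmod_Arg[of z] by (simp add: rcis_def)
  hence "x = spherical_coords (arccos t) (Arg z)"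
    using t unfolding spherical_coords_eq by (simp add: z_def t_def)
  thus thesis using t by (intro that) (auto simp: arccos_lbound arccos_ubound)
qed

text \<open>\<open>d\<close> is the signed distance from l \<phi> to a nearest point of pi/2 + 2 pi
  Z. Moving there linearly turns the sine into cos((1 - s) d), and cosine decreases on
  [0, pi].\<close>

lemma rotate_to_max:
  assumes "l \<ge> 1"
  obtains \<psi> where "sin (real l * \<psi>) = 1"
    "\<And>s. 0 \<le> s \<Longrightarrow> s \<le> 1 \<Longrightarrow> sin (real l * \<phi>) \<le> sin (real l * (\<phi> + s * (\<psi> - \<phi>)))"
proof -
  define d where "d = Arg (cis (real l * \<phi> - pi / 2))"
  have d: "\<bar>d\<bar> \<le> pi" using Arg_bounded[of "cis (real l * \<phi> - pi / 2)"] by (auto simp: d_def)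
  have "cis d = cis (real l * \<phi> - pi / 2)" by (simp add: d_def cis_Arg)
  hence "sin d = sin (real l * \<phi> - pi / 2) \<and> cos d = cos (real l * \<phi> - pi / 2)"
    by (simp add: complex_eq_iff)
  then obtain n :: int where n: "d = real l * \<phi> - pi / 2 + 2 * pi * n"
    unfolding sin_cos_eq_iff by auto
  define \<psi> where "\<psi> = (real l * \<phi> - d) / real l"
  have s: "sin (real l * (\<phi> + s * (\<psi> - \<phi>))) = cos ((1 - s) * d)" for s
  proof -
    have "real l * (\<phi> + s * (\<psi> - \<phi>)) = real l * \<phi> - s * d"
      using assms by (simp add: \<psi>_def field_simps)
    also have "\<dots> = (pi / 2 + (1 - s) * d) + 2 * pi * of_int (- n)"
      by (simp add: n field_simps)
    finally have "sin (real l * (\<phi> + s * (\<psi> - \<phi>))) = sin (pi / 2 + (1 - s) * d)"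
      using sin_cos_eq_iff by metis
    thus ?thesis by (simp add: sin_add)
  qed
  show thesis
  proof (rule that)
    show "sin (real l * \<psi>) = 1" using s[of 1] by simp
    fix s :: real assume "0 \<le> s" "s \<le> 1"
    hence "cos \<bar>d\<bar> \<le> cos \<bar>(1 - s) * d\<bar>"
      using d by (intro cos_monotone_0_pi_le) (auto simp: abs_mult mult_left_le_one_le)
    thus "sin (real l * \<phi>) \<le> sin (real l * (\<phi> + s * (\<psi> - \<phi>)))"
      using s[of s] s[of 0] by simp
  qed
qed

text \<open>A shift by pi/l changes the sign of sin(l \<phi>), which reduces the claim to the
  maximum.\<close>

lemma rotate_to_min:
  assumes "l \<ge> 1"
  obtains \<psi> where "sin (real l * \<psi>) = - 1"
    "\<And>s. 0 \<le> s \<Longrightarrow> s \<le> 1 \<Longrightarrow> sin (real l * (\<phi> + s * (\<psi> - \<phi>))) \<le> sin (real l * \<phi>)"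
proof -
  obtain \<psi> where \<psi>: "sin (real l * \<psi>) = 1"
    "\<And>s. 0 \<le> s \<Longrightarrow> s \<le> 1 \<Longrightarrow> sin (real l * (\<phi> + pi / l))
        \<le> sin (real l * (\<phi> + pi / l + s * (\<psi> - (\<phi> + pi / l))))"
    using rotate_to_max[OF assms, of "\<phi> + pi / l"] by blast
  have "real l * (x + pi / l) = real l * x + pi" for x using assms by (simp add: field_simps)
  hence shift: "sin (real l * (x + pi / l)) = - sin (real l * x)" for x by simp
  show thesis
  proof (rule that[of "\<psi> - pi / l"])
    show "sin (real l * (\<psi> - pi / l)) = - 1" using shift[of "\<psi> - pi / l"] \<psi>(1) by simp
    fix s :: real assume s: "0 \<le> s" "s \<le> 1"
    have "\<phi> + pi / l + s * (\<psi> - (\<phi> + pi / l)) = \<phi> + s * (\<psi> - pi / l - \<phi>) + pi / l" by simp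
    with \<psi>(2)[OF s] show "sin (real l * (\<phi> + s * (\<psi> - pi / l - \<phi>))) \<le> sin (real l * \<phi>)"
      by (simp only: shift)
  qed
qed

lemma continuous_on_horizontal [continuous_intros]:
  "continuous_on A f \<Longrightarrow> continuous_on A (\<lambda>x. horizontal (f x))"
  unfolding horizontal_def by (intro continuous_intros)

lemma continuous_on_H_harm: "continuous_on A (H_harm \<mu> l)"
  unfolding H_harm_eq[abs_def] by (intro continuous_intros)

context nodal_profile
begin

section \<open>The sign domains and their connection along meridians\<close>

definition pos_domain :: "(real ^ 3) set" where
  "pos_domain = {x \<in> unit_sphere. 0 < H_harm \<mu> l x}"

definition neg_domain :: "(real ^ 3) set" where
  "neg_domain = {x \<in> unit_sphere. H_harm \<mu> l x < 0}"

definition north :: "real ^ 3" where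
  "north = sphere_point 0 1"

lemma sin_power_squared: "(sin \<theta> ^ l)\<^sup>2 = (1 - (cos \<theta>)\<^sup>2) ^ l" for \<theta> :: real
  by (simp only: sin_squared_eq[symmetric] power_mult[symmetric] mult.commute)

text \<open>This is Q > 0 on |t| < a after taking roots: in the belt around the equator the sectoral
  term dominates.\<close>

lemma abs_legendre_less:
  assumes "\<bar>cos \<theta>\<bar> < a" "0 \<le> sin \<theta>"
  shows "\<bar>\<mu> * P (cos \<theta>)\<bar> < sin \<theta> ^ l"
proof -
  have "\<bar>cos \<theta>\<bar>\<^sup>2 < a\<^sup>2" using assms(1) by (intro power_strict_mono) auto
  hence "0 < poly (profile l \<mu>) (cos \<theta>)"
    using R_pos[of "cos \<theta>"] assms by (simp add: poly_profile_factor)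
  hence "\<bar>\<mu> * P (cos \<theta>)\<bar>\<^sup>2 < (sin \<theta> ^ l)\<^sup>2"
    unfolding poly_profile sin_power_squared by simp
  moreover have "0 \<le> sin \<theta> ^ l" using assms(2) by simp
  ultimately show ?thesis by (rule power2_less_imp_less)
qed

lemma abs_legendre_ge:
  assumes "a \<le> \<bar>cos \<theta>\<bar>"
  shows "sin \<theta> ^ l \<le> \<bar>\<mu> * P (cos \<theta>)\<bar>"
proof -
  have "poly (profile l \<mu>) (cos \<theta>) \<le> 0"
  proof (cases "a = \<bar>cos \<theta>\<bar>")
    case True
    hence "a\<^sup>2 = (cos \<theta>)\<^sup>2" by simp
    thus ?thesis by (simp add: poly_profile_factor)
  qed (use profile_neg[of "cos \<theta>"] assms in auto)
  hence "(sin \<theta> ^ l)\<^sup>2 \<le> \<bar>\<mu> * P (cos \<theta>)\<bar>\<^sup>2"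
    by (simp add: poly_profile sin_power_squared)
  thus ?thesis by (rule power2_le_imp_le) simp
qed

lemma legendre_pos_even: "even l \<Longrightarrow> a \<le> \<bar>t\<bar> \<Longrightarrow> \<bar>t\<bar> \<le> 1 \<Longrightarrow> 0 < P t"
  using legendre_pos[of "\<bar>t\<bar>"] poly_legendre_minus[of l t] by (auto simp: abs_if split: if_splits)

lemma legendre_neg_odd: "odd l \<Longrightarrow> t \<le> - a \<Longrightarrow> - 1 \<le> t \<Longrightarrow> P t < 0"
  using legendre_pos[of "- t"] poly_legendre_minus[of l t] by simp

text \<open>In the northern cap P_l > 0, in the belt sin^l dominates, and in the southern cap P_l >
  0 for even \<open>l\<close>. For odd \<open>l\<close> the southern cap cannot occur:
  \<open>\<theta>\<close> would lie there too, where P_l < 0 and \<mu> |P_l| is at least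
  sin^l.\<close>

lemma meridian_pos:
  assumes "0 < sin \<theta> ^ l + \<mu> * P (cos \<theta>)" "0 \<le> \<theta>'" "\<theta>' \<le> \<theta>" "\<theta> \<le> pi"
  shows "0 < sin \<theta>' ^ l + \<mu> * P (cos \<theta>')"
proof -
  have sin: "0 \<le> sin \<theta>'" using assms by (simp add: sin_ge_zero)
  consider "a \<le> cos \<theta>'" | "\<bar>cos \<theta>'\<bar> < a" | "cos \<theta>' \<le> - a" by linarith
  thus ?thesis
  proof cases
    case 1
    thus ?thesis using legendre_pos[of "cos \<theta>'"] mu_pos sin by (simp add: add_nonneg_pos)
  next
    case 2
    thus ?thesis using abs_legendre_less[OF 2 sin] by linarith
  next
    case 3
    show ?thesis
    proof (cases "even l")
      case True
      hence "0 < P (cos \<theta>')" using 3 a_pos by (intro legendre_pos_even) auto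
      thus ?thesis using mu_pos sin by (simp add: add_nonneg_pos)
    next
      case False
      have "cos \<theta> \<le> - a" using cos_monotone_0_pi_le[of \<theta>' \<theta>] assms 3 by linarith
      hence "\<mu> * P (cos \<theta>) < 0" "a \<le> \<bar>cos \<theta>\<bar>"
        using legendre_neg_odd[OF False, of "cos \<theta>"] mu_pos by (auto simp: mult_less_0_iff)
      with abs_legendre_ge[of \<theta>] assms(1) show ?thesis by linarith
    qed
  qed
qed

lemma pos_domain_connected:
  assumes "x \<in> pos_domain"
  shows "connected_component pos_domain x north"
proof -
  obtain \<theta> \<phi> where \<theta>: "0 \<le> \<theta>" "\<theta> \<le> pi" and x: "x = spherical_coords \<theta> \<phi>"
    using assms unit_sphere_spherical_coords by (auto simp: pos_domain_def)
  have sin: "0 \<le> sin \<theta> ^ l" using \<theta> by (simp add: sin_ge_zero)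
  have in_dom: "spherical_coords \<theta> \<phi> \<in> pos_domain
      \<longleftrightarrow> 0 < sin \<theta> ^ l * sin (real l * \<phi>) + \<mu> * P (cos \<theta>)" for \<theta> \<phi>
    by (simp add: pos_domain_def spherical_coords_in_sphere H_harm_spherical_coords)
  obtain \<psi> where \<psi>: "sin (real l * \<psi>) = 1"
    "\<And>s. 0 \<le> s \<Longrightarrow> s \<le> 1 \<Longrightarrow> sin (real l * \<phi>) \<le> sin (real l * (\<phi> + s * (\<psi> - \<phi>)))"
    using rotate_to_max[OF l_pos, of \<phi>] by blast
  have rot: "spherical_coords \<theta> (\<phi> + s * (\<psi> - \<phi>)) \<in> pos_domain" if "0 \<le> s" "s \<le> 1" for s
    using mult_left_mono[OF \<psi>(2)[OF that] sin] assms unfolding x in_dom by linarith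
  have "connected_component pos_domain (spherical_coords \<theta> (\<phi> + 0 * (\<psi> - \<phi>)))
      (spherical_coords \<theta> (\<phi> + 1 * (\<psi> - \<phi>)))"
    using rot by (intro connected_component_path_image continuous_intros) auto
  hence 1: "connected_component pos_domain x (spherical_coords \<theta> \<psi>)" by (simp add: x)
  have "0 < sin \<theta> ^ l + \<mu> * P (cos \<theta>)"
    using rot[of 1] \<psi>(1) unfolding in_dom by simp
  hence "connected_component pos_domain (spherical_coords 0 \<psi>) (spherical_coords \<theta> \<psi>)"
    using \<theta> meridian_pos[of \<theta>] \<psi>(1)
    by (intro connected_component_path_image continuous_intros) (auto simp: in_dom)
  moreover have "spherical_coords 0 \<psi> = north" by (simp add: spherical_coords_eq north_def)
  ultimately have "connected_component pos_domain (spherical_coords \<theta> \<psi>) north"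
    by (simp add: connected_component_sym)
  with 1 show ?thesis by (rule connected_component_trans)
qed

lemma north_in_pos_domain: "north \<in> pos_domain"
  using l_pos mu_pos
  by (simp add: pos_domain_def north_def in_unit_sphere_iff H_harm_eq poly_legendre_1 power_0_left)

lemma complement_nodal_set:
  "unit_sphere - nodal_set (H_harm \<mu> l) = pos_domain \<union> neg_domain"
  by (auto simp: nodal_set_def pos_domain_def neg_domain_def)

text \<open>The value 0, lying outside \<open>V\<close>, labels the connected positive domain and
  accounts for the extra component.\<close>

lemma card_nodal_domains:
  fixes f :: "real ^ 3 \<Rightarrow> complex"
  assumes "finite V" "0 \<notin> V" "continuous_on neg_domain f" "\<And>x. x \<in> neg_domain \<Longrightarrow> f x \<in> V"
    and "\<And>v. v \<in> V \<Longrightarrow> r v \<in> neg_domain" "\<And>v. v \<in> V \<Longrightarrow> f (r v) = v"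
    and "\<And>x. x \<in> neg_domain \<Longrightarrow> connected_component neg_domain x (r (f x))"
  shows "card (nodal_domains (H_harm \<mu> l)) = card V + 1"
proof -
  let ?H = "H_harm \<mu> l"
  let ?X = "pos_domain \<union> neg_domain"
  let ?F = "\<lambda>x. if 0 < ?H x then 0 else f x" and ?r = "\<lambda>v. if v = 0 then north else r v"
  have pos: "0 < ?H x" if "x \<in> pos_domain" for x using that by (simp add: pos_domain_def)
  have neg: "\<not> 0 < ?H x" if "x \<in> neg_domain" for x using that by (simp add: neg_domain_def)
  have "card (components ?X) = card (insert 0 V)"
  proof (rule card_components_eq_card_invariant[where F = ?F and r = ?r])
    have "{x \<in> ?X. ?H x < 0} = neg_domain" by (auto simp: pos_domain_def neg_domain_def)
    thus "continuous_on ?X ?F"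
      using assms(3) by (intro continuous_on_sign_cases continuous_on_H_harm)
         (auto simp: pos_domain_def neg_domain_def)
    show "connected_component ?X x (?r (?F x))" if x: "x \<in> ?X" for x
    proof (cases "x \<in> pos_domain")
      case True
      from pos_domain_connected[OF True] show ?thesis
        using pos[OF True] connected_component_of_subset[of pos_domain x north ?X] by simp
    next
      case False
      hence n: "x \<in> neg_domain" using x by simp
      hence "f x \<noteq> 0" using assms(2,4) by metis
      with neg[OF n] assms(7)[OF n] show ?thesis
        using connected_component_of_subset[of neg_domain x "r (f x)" ?X] by simp
    qed
  qed (use assms pos neg north_in_pos_domain in auto)
  thus ?thesis
    using assms(1,2) by (simp add: nodal_domains_def complement_nodal_set)
qed

section \<open>Nodal domains in odd degree\<close>

lemma H_harm_uminus:
  assumes "odd l"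
  shows "H_harm \<mu> l (- x) = - H_harm \<mu> l x"
proof -
  have "horizontal (- x) = - horizontal x" by (simp add: horizontal_def complex_eq_iff)
  thus ?thesis using assms by (simp add: H_harm_eq poly_legendre_minus)
qed

lemma card_nodal_domains_odd:
  assumes "odd l"
  shows "card (nodal_domains (H_harm \<mu> l)) = 2"
proof -
  have swap: "- x \<in> neg_domain \<longleftrightarrow> x \<in> pos_domain" for x
    using H_harm_uminus[OF assms, of x] by (auto simp: pos_domain_def neg_domain_def unit_sphere_def)
  have "connected_component neg_domain x (- north)" if "x \<in> neg_domain" for x
  proof -
    have "- x \<in> pos_domain" using that swap[of "- x"] by simp
    from pos_domain_connected[OF this] obtain T
      where T: "connected T" "T \<subseteq> pos_domain" "- x \<in> T" "north \<in> T"
      by (auto simp: connected_component_def)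
    have "connected (uminus ` T)" by (intro connected_continuous_image continuous_intros T)
    moreover have "uminus ` T \<subseteq> neg_domain" using T(2) swap by auto
    moreover have "x \<in> uminus ` T" using T(3) by (metis image_eqI minus_minus)
    ultimately show ?thesis using T(4) unfolding connected_component_def by blast
  qed
  hence "card (nodal_domains (H_harm \<mu> l)) = card {1 :: complex} + 1"
    by (intro card_nodal_domains[where f = "\<lambda>_. 1" and r = "\<lambda>_. - north"])
       (auto simp: swap north_in_pos_domain)
  thus ?thesis by simp
qed

section \<open>Nodal domains in even degree\<close>

lemma neg_domain_even_coords:
  assumes "even l" "spherical_coords \<theta> \<phi> \<in> neg_domain"
  shows "\<bar>cos \<theta>\<bar> < a"
proof (rule ccontr)
  assume "\<not> \<bar>cos \<theta>\<bar> < a"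
  hence a: "a \<le> \<bar>cos \<theta>\<bar>" by simp
  hence "0 < \<mu> * P (cos \<theta>)" using legendre_pos_even[OF assms(1) a] mu_pos by simp
  with abs_legendre_ge[OF a] have "sin \<theta> ^ l \<le> \<mu> * P (cos \<theta>)" by simp
  \<comment> \<open>\<open>\<theta>\<close> is not confined to [0, pi] here; the sign comes from the
    even exponent.\<close>
  moreover have "0 \<le> sin \<theta> ^ l" using assms(1) by (simp add: zero_le_even_power)
  hence "- (sin \<theta> ^ l) \<le> sin \<theta> ^ l * sin (real l * \<phi>)"
    using mult_left_mono[of "- 1" "sin (real l * \<phi>)" "sin \<theta> ^ l"] by simp
  ultimately show False using assms(2) by (simp add: neg_domain_def H_harm_spherical_coords)
qed

text \<open>On \<open>neg_domain\<close> the function \<open>\<i> * horizontal x ^ l\<close> avoids the branch cut of \<open>Ln\<close>, so that a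
  continuous \<open>l\<close>-th root of it exists. Dividing \<open>horizontal x\<close> by this root gives a locally
  constant function.\<close>

definition sector :: "real ^ 3 \<Rightarrow> complex" where
  "sector x = horizontal x * exp (- Ln (\<i> * horizontal x ^ l) / of_nat l)"

text \<open>On the branch cut z^l would lie on the nonnegative imaginary axis, so sin(l \<phi>) = 1;
  in the belt this makes H positive.\<close>

lemma neg_domain_even_not_nonpos:
  assumes "even l" "x \<in> neg_domain"
  shows "\<i> * horizontal x ^ l \<notin> \<real>\<^sub>\<le>\<^sub>0"
proof
  assume nonpos: "\<i> * horizontal x ^ l \<in> \<real>\<^sub>\<le>\<^sub>0"
  obtain \<theta> \<phi> where \<theta>: "0 \<le> \<theta>" "\<theta> \<le> pi" and x: "x = spherical_coords \<theta> \<phi>"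
    using assms unit_sphere_spherical_coords by (auto simp: neg_domain_def)
  have z: "horizontal x ^ l = of_real (sin \<theta> ^ l) * cis (real l * \<phi>)"
    by (simp add: x spherical_coords_eq power_mult_distrib Complex.DeMoivre)
  have a: "\<bar>cos \<theta>\<bar> < a" using neg_domain_even_coords assms x by blast
  have sin: "0 \<le> sin \<theta>" using \<theta> by (simp add: sin_ge_zero)
  note less = abs_legendre_less[OF a sin]
  hence pos: "0 < sin \<theta> ^ l" by linarith
  from nonpos have "sin \<theta> ^ l * cos (real l * \<phi>) = 0" "0 \<le> sin \<theta> ^ l * sin (real l * \<phi>)"
    by (auto simp: z complex_nonpos_Reals_iff simp flip: of_real_power)
  hence "cos (real l * \<phi>) = 0" "0 \<le> sin (real l * \<phi>)"
    using pos by (metis less_irrefl mult_eq_0_iff, metis zero_le_mult_iff leD)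
  hence "sin (real l * \<phi>) = 1" using sin_cos_squared_add[of "real l * \<phi>"] by (simp add: power2_eq_1_iff)
  hence "sin \<theta> ^ l + \<mu> * P (cos \<theta>) < 0"
    using assms(2) unfolding x neg_domain_def by (simp add: H_harm_spherical_coords)
  thus False using less by linarith
qed

lemma sector_power:
  assumes "even l" "x \<in> neg_domain"
  shows "sector x ^ l = - \<i>"
proof -
  let ?w = "horizontal x ^ l"
  have nz: "\<i> * ?w \<noteq> 0" using neg_domain_even_not_nonpos[OF assms] by (metis nonpos_Reals_zero_I)
  have "sector x ^ l = ?w * exp (- Ln (\<i> * ?w))"
    using l_pos by (simp add: sector_def power_mult_distrib flip: exp_of_nat_mult)
  also have "\<dots> = ?w / (\<i> * ?w)" by (simp only: exp_minus exp_Ln[OF nz] divide_inverse)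
  also have "\<dots> = - \<i>" using nz by (simp add: field_simps)
  finally show ?thesis .
qed

text \<open>Here i v^l = 1, and \<open>Ln 1 = 0\<close>.\<close>

lemma sector_at_root: "v ^ l = - \<i> \<Longrightarrow> sector (sphere_point v 0) = v"
  by (simp add: sector_def)

lemma root_in_neg_domain:
  assumes "v ^ l = - \<i>"
  shows "sphere_point v 0 \<in> neg_domain"
proof -
  have "norm v ^ l = 1" using assms by (simp flip: norm_power)
  hence "norm v = 1" using l_pos power_eq_imp_eq_base[of "norm v" l 1] by simp
  moreover have "\<bar>\<mu> * P (cos (pi / 2))\<bar> < sin (pi / 2) ^ l"
    using a_pos by (intro abs_legendre_less) auto
  ultimately show ?thesis
    using assms by (simp add: neg_domain_def in_unit_sphere_iff H_harm_eq)
qed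

text \<open>Rotating to a minimum of sin(l \<phi>) does not increase H. The meridian is then
  followed towards the equator, so |cos \<theta>| stays below \<open>a\<close> and sin^l keeps
  dominating.\<close>

lemma neg_domain_even_connected:
  assumes "even l" "x \<in> neg_domain"
  obtains v where "v ^ l = - \<i>" "connected_component neg_domain x (sphere_point v 0)"
proof -
  obtain \<theta> \<phi> where \<theta>: "0 \<le> \<theta>" "\<theta> \<le> pi" and x: "x = spherical_coords \<theta> \<phi>"
    using assms unit_sphere_spherical_coords by (auto simp: neg_domain_def)
  have sin: "0 \<le> sin \<theta> ^ l" using \<theta> by (simp add: sin_ge_zero)
  have in_dom: "spherical_coords \<theta> \<phi> \<in> neg_domain
      \<longleftrightarrow> sin \<theta> ^ l * sin (real l * \<phi>) + \<mu> * P (cos \<theta>) < 0" for \<theta> \<phi>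
    by (simp add: neg_domain_def spherical_coords_in_sphere H_harm_spherical_coords)
  obtain \<psi> where \<psi>: "sin (real l * \<psi>) = - 1"
    "\<And>s. 0 \<le> s \<Longrightarrow> s \<le> 1 \<Longrightarrow> sin (real l * (\<phi> + s * (\<psi> - \<phi>))) \<le> sin (real l * \<phi>)"
    using rotate_to_min[OF l_pos, of \<phi>] by blast
  have rot: "spherical_coords \<theta> (\<phi> + s * (\<psi> - \<phi>)) \<in> neg_domain" if "0 \<le> s" "s \<le> 1" for s
    using mult_left_mono[OF \<psi>(2)[OF that] sin] assms(2) unfolding x in_dom by linarith
  have "connected_component neg_domain (spherical_coords \<theta> (\<phi> + 0 * (\<psi> - \<phi>)))
      (spherical_coords \<theta> (\<phi> + 1 * (\<psi> - \<phi>)))"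
    using rot by (intro connected_component_path_image continuous_intros) auto
  hence 1: "connected_component neg_domain x (spherical_coords \<theta> \<psi>)" by (simp add: x)
  have a: "\<bar>cos \<theta>\<bar> < a" using neg_domain_even_coords assms x by blast
  have mer: "spherical_coords \<theta>' \<psi> \<in> neg_domain" if "0 \<le> \<theta>'" "\<theta>' \<le> pi" "\<bar>cos \<theta>'\<bar> < a" for \<theta>'
    using abs_legendre_less[of \<theta>'] that \<psi>(1) by (simp add: in_dom sin_ge_zero)
  have 2: "connected_component neg_domain (spherical_coords \<theta> \<psi>) (spherical_coords (pi / 2) \<psi>)"
  proof (cases "\<theta> \<le> pi / 2")
    case True
    have "spherical_coords \<theta>' \<psi> \<in> neg_domain" if "\<theta> \<le> \<theta>'" "\<theta>' \<le> pi / 2" for \<theta>'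
      using that True \<theta> a cos_monotone_0_pi_le[of \<theta> \<theta>'] cos_ge_zero[of \<theta>'] by (intro mer) auto
    thus ?thesis using True by (intro connected_component_path_image continuous_intros) auto
  next
    case False
    have "spherical_coords \<theta>' \<psi> \<in> neg_domain" if "pi / 2 \<le> \<theta>'" "\<theta>' \<le> \<theta>" for \<theta>'
      using that False \<theta> a cos_monotone_0_pi_le[of \<theta>' \<theta>] cos_monotone_0_pi_le[of "pi / 2" \<theta>']
      by (intro mer) auto
    hence "connected_component neg_domain (spherical_coords (pi / 2) \<psi>) (spherical_coords \<theta> \<psi>)"
      using False by (intro connected_component_path_image continuous_intros) auto
    thus ?thesis by (rule connected_component_sym)
  qed
  have "spherical_coords (pi / 2) \<psi> = sphere_point (cis \<psi>) 0" by (simp add: spherical_coords_eq)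
  moreover have "cis \<psi> ^ l = - \<i>"
    using \<psi>(1) sin_cos_squared_add[of "real l * \<psi>"]
    by (simp add: Complex.DeMoivre complex_eq_iff)
  ultimately show thesis using that[of "cis \<psi>"] connected_component_trans[OF 1 2] by simp
qed

lemma card_nodal_domains_even:
  assumes "even l"
  shows "card (nodal_domains (H_harm \<mu> l)) = l + 1"
proof -
  define V where "V = {v::complex. v ^ l = - \<i>}"
  have card: "card V = l" using l_pos by (simp add: V_def card_nth_roots)
  hence fin: "finite V" using l_pos card.infinite by fastforce
  have cont: "continuous_on neg_domain sector"
    unfolding sector_def using neg_domain_even_not_nonpos[OF assms] l_pos
    by (intro continuous_intros) auto
  have "connected_component neg_domain x (sphere_point (sector x) 0)" if x: "x \<in> neg_domain" for x
  proof -
    obtain v where v: "v ^ l = - \<i>" "connected_component neg_domain x (sphere_point v 0)"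
      using neg_domain_even_connected[OF assms x] by blast
    then obtain T where T: "connected T" "T \<subseteq> neg_domain" "x \<in> T" "sphere_point v 0 \<in> T"
      by (auto simp: connected_component_def)
    \<comment> \<open>\<open>sector\<close> is constant on the connected set \<open>T\<close>, so
      the equatorial root \<open>v\<close> reached from \<open>x\<close> is \<open>sector x\<close>
      itself.\<close>
    have "finite (sector ` T)"
      by (rule finite_subset[OF _ fin]) (use T sector_power[OF assms] in \<open>auto simp: V_def\<close>)
    hence "sector constant_on T"
      using T continuous_on_subset[OF cont] by (intro continuous_finite_range_constant)
    hence "sector x = v" using T sector_at_root[OF v(1)] by (auto simp: constant_on_def)
    thus ?thesis using v by simp
  qed
  hence "card (nodal_domains (H_harm \<mu> l)) = card V + 1"
    using fin cont sector_power[OF assms] root_in_neg_domain sector_at_root l_pos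
    by (intro card_nodal_domains[where f = sector and r = "\<lambda>v. sphere_point v 0"])
       (auto simp: V_def power_0_left)
  thus ?thesis by (simp add: card)
qed

end

theorem proposition1:
  fixes l :: nat and \<mu> :: real
  assumes "l \<ge> 1" and "0 < \<mu>" and "ereal \<mu> < mu_crit l"
  shows "(odd l \<longrightarrow>
            regular_simple_closed_curve (nodal_set (H_harm \<mu> l)) \<and>
            card (nodal_domains (H_harm \<mu> l)) = 2) \<and>
         (even l \<longrightarrow>
            (\<exists>\<C>. card \<C> = l \<and> disjoint \<C> \<and>
                 (\<forall>C\<in>\<C>. regular_simple_closed_curve C) \<and>
                 nodal_set (H_harm \<mu> l) = \<Union>\<C>) \<and>
            card (nodal_domains (H_harm \<mu> l)) = l + 1)"
proof -
  obtain a R where "0 < a" "a < 1" "profile l \<mu> = [:a\<^sup>2, 0, -1:] * R"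
    "\<And>t. \<bar>t\<bar> \<le> a \<Longrightarrow> 0 < poly R t"
    "\<And>t. a < \<bar>t\<bar> \<Longrightarrow> \<bar>t\<bar> \<le> 1 \<Longrightarrow> poly (profile l \<mu>) t < 0"
    "\<And>t. a \<le> t \<Longrightarrow> t \<le> 1 \<Longrightarrow> 0 < poly (legendre l) t"
    using profile_factorization[OF assms] by blast
  then interpret nodal_profile l \<mu> a R
    using assms by unfold_locales
  show ?thesis
    using nodal_set_odd card_nodal_domains_odd nodal_set_even card_nodal_domains_even by blast
qed

end
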